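(* For all positive integers $k$, $d$ and any graph $G$ of tree-depth $d$, we have $f_k(G) \leq (2k)^{d}$. If $d\geq k+1$, then $f_k(G) \leq (2k)^{k+1}\binom{d}{k+1}$. Moreover, $f_1(G)\leq \binom{d}{2}$.
   Context: All graphs are simple, finite and undirected. An induced forest in $G$ is an acyclic induced subgraph of $G$. For $k\geq 1$, a $k$-strong forest of $G$ is an induced forest in $G$ each of whose connected components has at least $k$ edges. An edge of $G$ is $k$-valid if it is contained in some $k$-strong forest of $G$. The $k$-strong induced arboricity $f_k(G)$ is the smallest number of $k$-strong forests of $G$ that together cover all $k$-valid edges of $G$ (so $f_k(G)=0$ if $G$ has no $k$-valid edges). The transitive closure of a rooted tree $T$ with root $r$ is the graph obtained from $T$ by adding every edge $uv$ such that $v$ lies on the $u$-$r$-path of $T$. A rooted tree has depth $d$ if the largest number of vertices on a path to the root is $d$. The tree-depth of a graph $G$ is the smallest integer $d$ such that each connected component of $G$ is a subgraph of the transitive closure of a rooted tree of depth $d$. *)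

theory Defs
  imports Main
begin

datatype 'a sgraph = Graph (verts: "'a set") (edges: "'a set set")

definition simple_graph :: "'a sgraph \<Rightarrow> bool" where
  "simple_graph G \<longleftrightarrow> finite (verts G) \<and>
     edges G \<subseteq> {{u, v} | u v. u \<in> verts G \<and> v \<in> verts G \<and> u \<noteq> v}"

definition induced_subgraph :: "'a sgraph \<Rightarrow> 'a set \<Rightarrow> 'a sgraph" where
  "induced_subgraph G S = Graph S {e \<in> edges G. e \<subseteq> S}"

definition is_path :: "'a sgraph \<Rightarrow> 'a list \<Rightarrow> bool" where
  "is_path G p \<longleftrightarrow> p \<noteq> [] \<and> distinct p \<and> set p \<subseteq> verts G \<and>
     successively (\<lambda>u v. {u, v} \<in> edges G) p"

definition is_cycle :: "'a sgraph \<Rightarrow> 'a list \<Rightarrow> bool" where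
  "is_cycle G p \<longleftrightarrow> is_path G p \<and> length p \<ge> 3 \<and> {last p, hd p} \<in> edges G"

definition acyclic_graph :: "'a sgraph \<Rightarrow> bool" where
  "acyclic_graph G \<longleftrightarrow> (\<nexists>p. is_cycle G p)"

definition joined :: "'a sgraph \<Rightarrow> 'a \<Rightarrow> 'a \<Rightarrow> bool" where
  "joined G u v \<longleftrightarrow> (\<exists>p. is_path G p \<and> hd p = u \<and> last p = v)"

definition connected_graph :: "'a sgraph \<Rightarrow> bool" where
  "connected_graph G \<longleftrightarrow> verts G \<noteq> {} \<and> (\<forall>u\<in>verts G. \<forall>v\<in>verts G. joined G u v)"

definition components :: "'a sgraph \<Rightarrow> 'a sgraph set" where
  "components G = (\<lambda>u. induced_subgraph G {v. joined G u v}) ` verts G"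


definition induced_forest :: "'a sgraph \<Rightarrow> 'a sgraph \<Rightarrow> bool" where
  "induced_forest G F \<longleftrightarrow>
     (\<exists>S \<subseteq> verts G. F = induced_subgraph G S) \<and> acyclic_graph F"

definition strong_forest :: "nat \<Rightarrow> 'a sgraph \<Rightarrow> 'a sgraph \<Rightarrow> bool" where
  "strong_forest k G F \<longleftrightarrow>
     induced_forest G F \<and> (\<forall>C\<in>components F. card (edges C) \<ge> k)"

definition valid_edge :: "nat \<Rightarrow> 'a sgraph \<Rightarrow> 'a set \<Rightarrow> bool" where
  "valid_edge k G e \<longleftrightarrow> e \<in> edges G \<and> (\<exists>F. strong_forest k G F \<and> e \<in> edges F)"

definition strong_induced_arboricity :: "nat \<Rightarrow> 'a sgraph \<Rightarrow> nat" where
  "strong_induced_arboricity k G =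
     (LEAST n. \<exists>\<F>. finite \<F> \<and> card \<F> = n \<and> (\<forall>F\<in>\<F>. strong_forest k G F) \<and>
        (\<forall>e. valid_edge k G e \<longrightarrow> (\<exists>F\<in>\<F>. e \<in> edges F)))"


definition rooted_tree :: "'a sgraph \<Rightarrow> 'a \<Rightarrow> bool" where
  "rooted_tree T r \<longleftrightarrow>
     simple_graph T \<and> connected_graph T \<and> acyclic_graph T \<and> r \<in> verts T"

text \<open>The condition \<open>u \<noteq> v\<close> only prevents loops, since \<open>u\<close> itself lies on the path from \<open>u\<close> to \<open>r\<close>.\<close>
definition transitive_closure :: "'a sgraph \<Rightarrow> 'a \<Rightarrow> 'a sgraph" where
  "transitive_closure T r = Graph (verts T)
     (edges T \<union> {{u, v} | u v. u \<noteq> v \<and>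
        (\<exists>p. is_path T p \<and> hd p = u \<and> last p = r \<and> v \<in> set p)})"

definition rooted_depth :: "'a sgraph \<Rightarrow> 'a \<Rightarrow> nat" where
  "rooted_depth T r = Max {length p | p. is_path T p \<and> last p = r}"

definition embeds :: "'a sgraph \<Rightarrow> 'b sgraph \<Rightarrow> bool" where
  "embeds H G \<longleftrightarrow> (\<exists>\<phi>. inj_on \<phi> (verts H) \<and> \<phi> ` verts H \<subseteq> verts G \<and>
     (\<forall>e\<in>edges H. \<phi> ` e \<in> edges G))"

text \<open>The trees may need more vertices than the component (or the vertex type of \<open>G\<close>) has, so they
  live on \<open>nat\<close>, which carries a copy of every finite tree; being a subgraph is accordingly read up
  to isomorphism.\<close>
definition tree_depth :: "'a sgraph \<Rightarrow> nat" where
  "tree_depth G = (LEAST d. \<forall>C\<in>components G. \<exists>(T :: nat sgraph) r.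
     rooted_tree T r \<and> rooted_depth T r = d \<and> embeds C (transitive_closure T r))"

end

(*
  An elimination forest of depth d labels every vertex with the list of its ancestors, from the root
  down to the vertex itself; ancestors become prefixes and adjacent vertices are comparable.

  Let e = uv be a valid edge, u above v, inside an induced tree X with at least k edges. On the way
  from the top of X down to v, at every level l, let beta(l) be the lowest vertex at level at most l
  from which X reaches u without leaving the subtree below that vertex. It has a neighbour in the
  subtree entered next. If at every level fewer than k child subtrees contain a neighbour of beta(l),
  then v is determined by the top of X, the set J of levels of the vertices beta(l), and, per level,
  the index of the next child among these fewer than k candidates; X itself is the tree assigned to e.
  Otherwise take the lowest level with at least k candidates and put b = beta(l). Now it suffices to
  keep the part of X below the next child together with b, since one neighbour of b in each other
  candidate subtree makes the tree large enough. The value k - 1, which is never an index, marks this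
  level.

  All this is a function from the d levels to bool x {..<k}. Two edges with the same function and the
  same b enter different subtrees at the same level unless they are equal, and different tops b lie
  at the same level, so all trees assigned to one function fit together into one k-strong forest. This
  gives (2k)^d. A tree with k edges meets at most k + 1 levels, and the subgraph induced by k + 1
  levels again has a labelling, now of depth k + 1; this gives the second bound. For k = 1 the edges
  between two given levels form disjoint stars.
*)

theory Submission
  imports Defs "HOL-Library.Sublist" "HOL-Library.FuncSet"
begin

section \<open>Induced trees\<close>

definition adj :: "'a sgraph \<Rightarrow> 'a \<Rightarrow> 'a \<Rightarrow> bool" where
  "adj G u v \<longleftrightarrow> {u, v} \<in> edges G"

definition steps :: "'a sgraph \<Rightarrow> 'a set \<Rightarrow> ('a \<times> 'a) set" where
  "steps G X = {(a, b). a \<in> X \<and> b \<in> X \<and> adj G a b}"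

definition connected_in :: "'a sgraph \<Rightarrow> 'a set \<Rightarrow> bool" where
  "connected_in G X \<longleftrightarrow> (\<forall>a\<in>X. \<forall>b\<in>X. (a, b) \<in> (steps G X)\<^sup>*)"

definition path_in :: "'a sgraph \<Rightarrow> 'a set \<Rightarrow> 'a list \<Rightarrow> bool" where
  "path_in G X p \<longleftrightarrow> p \<noteq> [] \<and> distinct p \<and> set p \<subseteq> X \<and> successively (adj G) p"

definition acyclic_in :: "'a sgraph \<Rightarrow> 'a set \<Rightarrow> bool" where
  "acyclic_in G X \<longleftrightarrow> \<not> (\<exists>p. path_in G X p \<and> length p \<ge> 3 \<and> adj G (last p) (hd p))"

text \<open>Induced trees, built from the root by adding leaves: in this form gluing at the root is an easy
  induction, whereas cycles through the glued vertex would have to be taken apart.\<close>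
inductive grown :: "'a sgraph \<Rightarrow> 'a \<Rightarrow> 'a set \<Rightarrow> bool" for G r where
  root: "grown G r {r}"
| grow: "grown G r A \<Longrightarrow> x \<notin> A \<Longrightarrow> y \<in> A \<Longrightarrow> adj G x y \<Longrightarrow>
    (\<And>z. z \<in> A \<Longrightarrow> adj G x z \<Longrightarrow> z = y) \<Longrightarrow> grown G r (insert x A)"

lemma adj_commute: "adj G u v \<longleftrightarrow> adj G v u"
  by (simp add: adj_def insert_commute)

lemma adj_vertsD:
  assumes "simple_graph G" "adj G u v"
  shows "u \<in> verts G" "v \<in> verts G" "u \<noteq> v"
  using assms by (fastforce simp: simple_graph_def adj_def doubleton_eq_iff)+

lemma edge_endpoints:
  assumes "simple_graph G" "e \<in> edges G"
  shows "\<exists>u v. e = {u, v} \<and> adj G u v \<and> u \<noteq> v"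
  using assms by (fastforce simp: simple_graph_def adj_def)

lemma sym_steps: "sym (steps G X)"
  by (auto simp: sym_def steps_def adj_commute)

lemma steps_sym: "(a, b) \<in> (steps G X)\<^sup>* \<Longrightarrow> (b, a) \<in> (steps G X)\<^sup>*"
  using sym_rtrancl[OF sym_steps] by (meson symD)

lemma steps_mono: "X \<subseteq> Y \<Longrightarrow> (a, b) \<in> (steps G X)\<^sup>* \<Longrightarrow> (a, b) \<in> (steps G Y)\<^sup>*"
  by (erule rtrancl_mono[THEN subsetD, rotated]) (auto simp: steps_def)

lemma steps_mem: "(a, b) \<in> (steps G X)\<^sup>* \<Longrightarrow> a \<in> X \<Longrightarrow> b \<in> X"
  by (induction rule: rtrancl_induct) (auto simp: steps_def)

lemma acyclic_in_subset: "acyclic_in G X \<Longrightarrow> Y \<subseteq> X \<Longrightarrow> acyclic_in G Y"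
  by (force simp: acyclic_in_def path_in_def)

lemma path_in_steps:
  "path_in G X p \<Longrightarrow> (hd p, last p) \<in> (steps G X)\<^sup>*"
proof (induction p)
  case (Cons a p)
  show ?case
  proof (cases p)
    case (Cons b q)
    then have "path_in G X p" "(a, b) \<in> steps G X"
      using Cons.prems by (auto simp: path_in_def steps_def)
    then show ?thesis using Cons.IH Cons by (auto intro: converse_rtrancl_into_rtrancl)
  qed simp
qed (simp add: path_in_def)

lemma steps_path_in:
  assumes "(a, b) \<in> (steps G X)\<^sup>*" "a \<in> X"
  shows "\<exists>p. path_in G X p \<and> hd p = a \<and> last p = b"
  using assms
proof (induction rule: rtrancl_induct)
  case base
  then show ?case by (intro exI[of _ "[a]"]) (simp add: path_in_def)
next
  case (step b c)
  then obtain p where p: "path_in G X p" "hd p = a" "last p = b" by auto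
  show ?case
  \<comment> \<open>A path that already contains the next vertex of the walk is cut off there, so it
    stays free of repetitions.\<close>
  proof (cases "c \<in> set p")
    case True
    then obtain q q' where q: "p = q @ c # q'" by (meson split_list)
    have "path_in G X (q @ [c])"
      using p(1) by (auto simp: q path_in_def successively_append_iff)
    moreover have "hd (q @ [c]) = a" using p(2) by (cases q) (auto simp: q)
    ultimately show ?thesis by (metis last_snoc)
  next
    case False
    have "path_in G X (p @ [c])" "hd (p @ [c]) = a"
      using p False step.hyps(2) by (auto simp: path_in_def successively_append_iff steps_def)
    then show ?thesis by (metis last_snoc)
  qed
qed

lemma ex_path_in:
  "(\<exists>p. path_in G X p \<and> hd p = u \<and> last p = v) \<longleftrightarrow> u \<in> X \<and> (u, v) \<in> (steps G X)\<^sup>*"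
proof
  assume "\<exists>p. path_in G X p \<and> hd p = u \<and> last p = v"
  then obtain p where p: "path_in G X p" "hd p = u" "last p = v" by blast
  then show "u \<in> X \<and> (u, v) \<in> (steps G X)\<^sup>*"
    using path_in_steps[OF p(1)] by (auto simp: path_in_def)
qed (use steps_path_in in metis)

text \<open>At the two ends of the list the closing edge supplies the second neighbour. Hence a
  vertex with only one neighbour lies on no cycle.\<close>

lemma cycle_neighbours:
  assumes "path_in G X p" "length p \<ge> 3" "adj G (last p) (hd p)" "x \<in> set p"
  obtains y z where "y \<in> set p" "z \<in> set p" "y \<noteq> z" "y \<noteq> x" "z \<noteq> x" "adj G x y" "adj G x z"
proof -
  obtain q q' where p: "p = q @ x # q'" by (meson assms(4) split_list)
  have d: "distinct p" and s: "successively (adj G) p" using assms(1) by (auto simp: path_in_def)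
  consider "q = []" | "q' = []" | "q \<noteq> []" "q' \<noteq> []" by auto
  then show thesis
  proof cases
    case 1
    obtain y q'' where q': "q' = y # q''" "q'' \<noteq> []"
      using assms(2) 1 p by (cases q'; cases "tl q'") auto
    show ?thesis
      by (rule that[of y "last q''"])
        (use 1 q' d s assms(3) in \<open>auto simp: p adj_commute\<close>)
  next
    case 2
    obtain y q'' where q: "q = q'' @ [y]" "q'' \<noteq> []"
      using assms(2) 2 p by (cases q rule: rev_cases; cases "butlast q" rule: rev_cases) auto
    show ?thesis
      by (rule that[of y "hd q''"])
        (use 2 q d s assms(3) in \<open>auto simp: p successively_append_iff adj_commute\<close>)
  next
    case 3
    show ?thesis
      by (rule that[of "last q" "hd q'"])
        (use 3 d s in \<open>auto simp: p successively_append_iff successively_Cons adj_commute dest: last_in_set hd_in_set\<close>)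
  qed
qed

lemma grown_root: "grown G r A \<Longrightarrow> r \<in> A"
  by (induction rule: grown.induct) auto

lemma grown_finite: "grown G r A \<Longrightarrow> finite A"
  by (induction rule: grown.induct) auto

lemma connected_inI:
  assumes "\<And>a. a \<in> X \<Longrightarrow> (a, y) \<in> (steps G X)\<^sup>*"
  shows "connected_in G X"
  unfolding connected_in_def
proof (intro ballI)
  fix a b assume "a \<in> X" "b \<in> X"
  then show "(a, b) \<in> (steps G X)\<^sup>*" by (intro rtrancl_trans[OF assms steps_sym[OF assms]])
qed

text \<open>All vertices visited by a walk from \<open>u\<close> are reachable from
  \<open>u\<close>, so the walk never leaves the component.\<close>

lemma steps_component:
  assumes "(u, w) \<in> (steps G X)\<^sup>*"
  shows "(u, w) \<in> (steps G {w. (u, w) \<in> (steps G X)\<^sup>*})\<^sup>*"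
  using assms
proof (induction rule: rtrancl_induct)
  case (step y z)
  then have "(y, z) \<in> steps G {w. (u, w) \<in> (steps G X)\<^sup>*}"
    by (auto simp: steps_def intro: rtrancl_into_rtrancl)
  then show ?case using step.IH by (rule rtrancl_into_rtrancl[rotated])
qed simp

lemma connected_component: "connected_in G {w. (u, w) \<in> (steps G X)\<^sup>*}"
  by (rule connected_inI[of _ u]) (use steps_component steps_sym in fast)

lemma connected_insert:
  assumes "connected_in G A" "y \<in> A" "adj G x y"
  shows "connected_in G (insert x A)"
proof (rule connected_inI)
  fix a assume a: "a \<in> insert x A"
  show "(a, y) \<in> (steps G (insert x A))\<^sup>*"
  proof (cases "a = x")
    case True
    then show ?thesis using assms by (auto simp: steps_def)
  next
    case False
    then have "(a, y) \<in> (steps G A)\<^sup>*" using a assms by (auto simp: connected_in_def)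
    then show ?thesis by (rule steps_mono[rotated]) auto
  qed
qed

lemma grown_connected: "grown G r A \<Longrightarrow> connected_in G A"
  by (induction rule: grown.induct) (auto simp: connected_in_def[of _ "{r}"] intro: connected_insert)

text \<open>The vertex added last has a single neighbour in the set, whereas a cycle through it
  would give it two.\<close>

lemma grown_acyclic: "grown G r A \<Longrightarrow> acyclic_in G A"
proof (induction rule: grown.induct)
  case root
  show ?case
    unfolding acyclic_in_def
  proof safe
    fix p assume "path_in G {r} p" "length p \<ge> 3"
    then have "card (set p) \<ge> 3" "set p \<subseteq> {r}" by (auto simp: path_in_def distinct_card)
    then show False using card_mono[of "{r}" "set p"] by simp
  qed
next
  case (grow A x y)
  show ?case
    unfolding acyclic_in_def
  proof safe
    fix p assume p: "path_in G (insert x A) p" "length p \<ge> 3" "adj G (last p) (hd p)"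
    show False
    proof (cases "x \<in> set p")
      case True
      obtain a b where ab: "a \<in> set p" "b \<in> set p" "a \<noteq> b" "a \<noteq> x" "b \<noteq> x" "adj G x a" "adj G x b"
        using cycle_neighbours[OF p True] by blast
      then have "a \<in> A" "b \<in> A" using p(1) by (auto simp: path_in_def)
      then show False using ab grow.hyps(5) by metis
    next
      case False
      then have "path_in G A p" using p(1) by (auto simp: path_in_def)
      then show False using p grow.IH by (auto simp: acyclic_in_def)
    qed
  qed
qed

text \<open>A walk from \<open>A\<close> to a vertex outside has to cross the boundary of
  \<open>A\<close>.\<close>

lemma connected_extend:
  assumes "connected_in G X" "A \<subset> X" "A \<noteq> {}"
  obtains x y where "x \<in> X" "x \<notin> A" "y \<in> A" "adj G x y"
proof -
  obtain a b where ab: "a \<in> A" "b \<in> X" "b \<notin> A" using assms by auto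
  then have "(a, b) \<in> (steps G X)\<^sup>*" using assms by (auto simp: connected_in_def)
  then have "b \<notin> A \<longrightarrow> (\<exists>x y. x \<in> X \<and> x \<notin> A \<and> y \<in> A \<and> adj G x y)"
    by (induction rule: rtrancl_induct) (use ab in \<open>auto simp: steps_def, metis adj_commute\<close>)
  then show thesis using that ab by blast
qed

text \<open>Two neighbours of \<open>x\<close> in \<open>A\<close> would be joined by a path inside
  \<open>A\<close>, and \<open>x\<close> would close it to a cycle.\<close>

lemma grown_extend:
  assumes "grown G r A" "acyclic_in G (insert x A)" "x \<notin> A" "y \<in> A" "adj G x y"
  shows "grown G r (insert x A)"
proof (rule grown.grow[OF assms(1,3,4,5)])
  fix z assume z: "z \<in> A" "adj G x z"
  show "z = y"
  proof (rule ccontr)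
    assume ne: "z \<noteq> y"
    have "(y, z) \<in> (steps G A)\<^sup>*"
      using grown_connected[OF assms(1)] z assms(4) by (auto simp: connected_in_def)
    then obtain p where p: "path_in G A p" "hd p = y" "last p = z"
      using steps_path_in assms(4) by metis
    have "length p \<ge> 2" using p ne by (cases p; cases "tl p") (auto simp: path_in_def)
    moreover have "path_in G (insert x A) (x # p)"
      using p assms(3,5) by (cases p) (auto simp: path_in_def)
    moreover have "adj G (last (x # p)) (hd (x # p))" 
      using p z by (auto simp: path_in_def adj_commute)
    ultimately show False using assms(2) unfolding acyclic_in_def by fastforce
  qed
qed

text \<open>The set grows by one boundary vertex at a time. Started from an edge inside a tree, this
  yields a subtree with exactly \<open>k + 1\<close> vertices, which meets at most
  \<open>k + 1\<close> levels.\<close>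

lemma connected_subset_of_card:
  assumes "connected_in G X" "finite X" "A \<subseteq> X" "connected_in G A" "A \<noteq> {}"
    "card A \<le> n" "n \<le> card X"
  shows "\<exists>A'. A \<subseteq> A' \<and> A' \<subseteq> X \<and> connected_in G A' \<and> card A' = n"
  using assms(6,7)
proof (induction n rule: dec_induct)
  case base
  then show ?case using assms by auto
next
  case (step n)
  then obtain A' where A': "A \<subseteq> A'" "A' \<subseteq> X" "connected_in G A'" "card A' = n" by auto
  have "A' \<subset> X" "A' \<noteq> {}" using A' step assms(5) by auto
  then obtain x y where xy: "x \<in> X" "x \<notin> A'" "y \<in> A'" "adj G x y"
    using connected_extend[OF assms(1)] by metis
  have "finite A'" using A' assms(2) finite_subset by blast
  then show ?case
    using A' xy connected_insert[of G A' y x] by (intro exI[of _ "insert x A'"]) auto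
qed

text \<open>Leaves are added greedily, starting from \<open>r\<close>, until all of \<open>X\<close>
  is reached; so any vertex of an induced tree can serve as its root.\<close>

lemma grownI:
  assumes "connected_in G X" "acyclic_in G X" "finite X" "r \<in> X"
  shows "grown G r X"
proof -
  have "\<exists>A \<subseteq> X. card A = n \<and> grown G r A" if "1 \<le> n" "n \<le> card X" for n
    using that
  proof (induction n rule: dec_induct)
    case base
    show ?case by (rule exI[of _ "{r}"]) (use assms in \<open>auto intro: grown.root\<close>)
  next
    case (step n)
    then obtain A where A: "A \<subseteq> X" "card A = n" "grown G r A" by auto
    then have "A \<subset> X" "A \<noteq> {}" using step by (auto dest: grown_root)
    then obtain x y where xy: "x \<in> X" "x \<notin> A" "y \<in> A" "adj G x y"
      using connected_extend[OF assms(1)] by metis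
    then have "grown G r (insert x A)"
      using grown_extend[OF A(3)] acyclic_in_subset[OF assms(2)] A(1) by simp
    then show ?case using A xy grown_finite[OF A(3)] by (intro exI[of _ "insert x A"]) auto
  qed
  moreover have "card X \<ge> 1" using assms(3,4) by (metis One_nat_def Suc_leI card_gt_0_iff empty_iff)
  ultimately obtain A where "A \<subseteq> X" "card A = card X" "grown G r A" by blast
  then show ?thesis using card_subset_eq[OF assms(3)] by metis
qed

text \<open>The construction of \<open>B\<close> is repeated on top of \<open>A\<close>: a vertex of
  \<open>B\<close> other than \<open>r\<close> has no neighbour in \<open>A - {r}\<close>, so it is
  still attached as a leaf.\<close>

lemma grown_glue:
  assumes "grown G r A" "grown G r B"
    "\<And>x y. x \<in> A - {r} \<Longrightarrow> y \<in> B - {r} \<Longrightarrow> x \<noteq> y \<and> \<not> adj G x y"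
  shows "grown G r (A \<union> B)"
  using assms(2,3)
proof (induction rule: grown.induct)
  case root
  then show ?case using assms(1) grown_root by (metis insert_absorb Un_insert_right sup_bot_right)
next
  case (grow B x y)
  have r: "r \<in> A" "r \<in> B" using grown_root assms(1) grow by metis+
  then have "x \<noteq> r" using grow by blast
  have 1: "grown G r (A \<union> B)" using grow by blast
  have "grown G r (insert x (A \<union> B))"
  proof (rule grown.grow[OF 1])
    show "x \<notin> A \<union> B" using grow.hyps(2) grow.prems \<open>x \<noteq> r\<close> by blast
    show "y \<in> A \<union> B" using grow by blast
    show "adj G x y" using grow by blast
    fix z assume z: "z \<in> A \<union> B" "adj G x z"
    then have "z \<in> B" using grow.prems[of z x] \<open>x \<noteq> r\<close> r by (auto simp: adj_commute)
    then show "z = y" using grow z by blast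
  qed
  then show ?case by simp
qed

text \<open>Every leaf brings exactly one new edge. This turns bounds on the edges of a component
  into bounds on its vertices.\<close>

lemma grown_card_edges:
  assumes "simple_graph G"
  shows "grown G r A \<Longrightarrow> finite {e \<in> edges G. e \<subseteq> A} \<and> card {e \<in> edges G. e \<subseteq> A} + 1 = card A"
proof (induction rule: grown.induct)
  case root
  have "\<not> e \<subseteq> {r}" if e: "e \<in> edges G" for e
  proof -
    obtain a b where "e = {a, b}" "a \<noteq> b" using edge_endpoints[OF assms e] by auto
    then show ?thesis by auto
  qed
  then have "{e \<in> edges G. e \<subseteq> {r}} = {}" by blast
  then show ?case by simp
next
  case (grow A x y)
  have "e \<subseteq> A \<or> e = {x, y}" if e: "e \<in> edges G" "e \<subseteq> insert x A" for e
  proof -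
    obtain a b where ab: "e = {a, b}" "adj G a b" "a \<noteq> b" using edge_endpoints[OF assms e(1)] by auto
    then have "a \<in> A \<and> b \<in> A \<or> a = x \<and> b \<in> A \<or> b = x \<and> a \<in> A" using e by auto
    then show ?thesis using ab grow.hyps(5) by (auto simp: adj_commute)
  qed
  moreover have "{x, y} \<in> edges G" "{x, y} \<subseteq> insert x A"
    using grow.hyps(3,4) by (auto simp: adj_def)
  ultimately have "{e \<in> edges G. e \<subseteq> insert x A} = insert {x, y} {e \<in> edges G. e \<subseteq> A}"
    by blast
  moreover have "{x, y} \<notin> {e \<in> edges G. e \<subseteq> A}" using grow.hyps(2) by auto
  ultimately show ?case using grow.IH grow.hyps(2) grown_finite[OF grow.hyps(1)] by simp
qed

section \<open>Labellings by an elimination forest\<close>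

text \<open>The set \<open>X\<close> spans an induced tree, so \<open>k + 1 \<le> card X\<close> says that it has at least \<open>k\<close> edges.\<close>
definition core :: "'a sgraph \<Rightarrow> nat \<Rightarrow> 'a set \<Rightarrow> 'a set \<Rightarrow> bool" where
  "core G k e X \<longleftrightarrow> e \<in> edges G \<and> e \<subseteq> X \<and> X \<subseteq> verts G \<and>
     connected_in G X \<and> acyclic_in G X \<and> k + 1 \<le> card X"

text \<open>The label of \<open>v\<close> is the path from a root of the elimination forest to \<open>v\<close>; its length is the level
  of \<open>v\<close>. Labels may skip nodes of the forest, as not every node need be a vertex.\<close>
locale labelled_graph =
  fixes G :: "'a sgraph" and lab :: "'a \<Rightarrow> 'b list" and d :: nat
  assumes simple: "simple_graph G"
    and inj: "inj_on lab (verts G)"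
    and nonempty: "v \<in> verts G \<Longrightarrow> lab v \<noteq> []"
    and length_le: "v \<in> verts G \<Longrightarrow> length (lab v) \<le> d"
    and comparable: "adj G u v \<Longrightarrow> prefix (lab u) (lab v) \<or> prefix (lab v) (lab u)"
begin

definition below :: "'b list \<Rightarrow> 'a set" where
  "below w = {v \<in> verts G. prefix w (lab v)}"

text \<open>The argument \<open>l\<close> is the label of a vertex \<open>a\<close> with \<open>prefix l w\<close>: the children of the node \<open>w\<close> whose
  subtrees contain a neighbour of \<open>a\<close>. Referring to \<open>a\<close> by its label allows to recover the set from a
  level and a label below.\<close>
definition branches :: "'b list \<Rightarrow> 'b list \<Rightarrow> 'b set" where
  "branches l w = {x. \<exists>a y. lab a = l \<and> adj G a y \<and> prefix (w @ [x]) (lab y)}"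

text \<open>The candidates for \<open>\<beta>(l)\<close>.\<close>
definition ancestors :: "'a set \<Rightarrow> 'a \<Rightarrow> 'a set" where
  "ancestors X u = {a \<in> X. (a, u) \<in> (steps G (X \<inter> below (lab a)))\<^sup>*}"

text \<open>The data assigned to the edge \<open>uv\<close>: the tree on \<open>insert b D\<close> hangs from \<open>b\<close> into the subtree of the
  node \<open>take q (lab v)\<close>, and \<open>J\<close> is the set of levels of \<open>v\<close> and of the candidates from \<open>b\<close> downwards.
  So \<open>Max (J \<inter> {..l})\<close> is the level of \<open>\<beta>(l)\<close>. Either \<open>b\<close> is the top of the whole tree, and then
  \<open>q\<close> is its own level, or \<open>q - 1\<close> is the lowest level with at least \<open>k\<close> branches.\<close>
definition cert :: "nat \<Rightarrow> 'a \<Rightarrow> 'a \<Rightarrow> 'a \<Rightarrow> nat \<Rightarrow> 'a set \<Rightarrow> nat set \<Rightarrow> bool" where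
  "cert k u v b q D J \<longleftrightarrow>
     adj G u v \<and> length (lab u) < length (lab v) \<and>
     b \<in> verts G \<and> prefix (lab b) (lab v) \<and> length (lab b) \<le> q \<and> q \<le> length (lab v) \<and>
     grown G b (insert b D) \<and> b \<notin> D \<and> u \<in> insert b D \<and> v \<in> D \<and> D \<subseteq> below (take q (lab v)) \<and>
     J \<subseteq> {length (lab b)..length (lab v)} \<and> length (lab b) \<in> J \<and> length (lab v) \<in> J \<and>
     length (lab u) = Max (J \<inter> {..<length (lab v)}) \<and>
     (\<forall>l. q \<le> l \<and> l < length (lab v) \<longrightarrow>
        lab v ! l \<in> branches (take (Max (J \<inter> {..l})) (lab v)) (take l (lab v)) \<and>
        card (branches (take (Max (J \<inter> {..l})) (lab v)) (take l (lab v))) < k) \<and>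
     (if q = length (lab b) then k \<le> card D
      else lab v ! (q - 1) \<in> branches (lab b) (take (q - 1) (lab v)) \<and>
        k \<le> card (branches (lab b) (take (q - 1) (lab v))))"

lemma finite_verts: "finite (verts G)"
  using simple by (simp add: simple_graph_def)

lemma adj_verts:
  assumes "adj G u v" shows "u \<in> verts G" "v \<in> verts G" "u \<noteq> v"
  using adj_vertsD[OF simple assms] by auto

text \<open>Prefixes of one list are determined by their lengths; hence an ancestor can be recovered
  from its level.\<close>

lemma prefix_lab_unique:
  assumes "a \<in> verts G" "b \<in> verts G" "prefix (lab a) w" "prefix (lab b) w"
    "length (lab a) = length (lab b)"
  shows "a = b"
proof -
  have "lab a = lab b" using assms(3-5) by (metis prefix_def append_eq_append_conv)
  then show ?thesis using inj assms(1,2) by (auto dest: inj_onD)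
qed

lemma adj_length_prefix:
  assumes "adj G u v" "length (lab u) \<le> length (lab v)"
  shows "prefix (lab u) (lab v)"
  using comparable[OF assms(1)]
proof
  assume "prefix (lab v) (lab u)"
  then show ?thesis using assms(2) by (auto simp: prefix_def)
qed

lemma adj_levels:
  assumes "adj G x y" shows "length (lab x) \<noteq> length (lab y)"
proof
  assume "length (lab x) = length (lab y)"
  then have "lab x = lab y" using comparable[OF assms] by (auto simp: prefix_def)
  then show False using adj_verts[OF assms] inj by (auto dest: inj_onD)
qed

lemma oriented_edge:
  assumes "e \<in> edges G"
  shows "\<exists>u v. e = {u, v} \<and> adj G u v \<and> length (lab u) < length (lab v)"
proof -
  obtain x y where xy: "e = {x, y}" "adj G x y"
    using edge_endpoints[OF simple assms] by auto
  show ?thesis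
  proof (cases "length (lab x) < length (lab y)")
    case False
    then have "length (lab y) < length (lab x)" using adj_levels[OF xy(2)] by simp
    moreover have "e = {y, x}" "adj G y x" using xy adj_commute[of G x y] by auto
    ultimately show ?thesis by blast
  qed (use xy in blast)
qed

text \<open>Along a walk each label is either extended or shortened to a prefix, and as
  \<open>b\<close> has the least level, shortening never goes beyond \<open>lab b\<close>.\<close>

lemma connected_below_top:
  assumes "connected_in G X" "b \<in> X" "x \<in> X"
    "\<And>x. x \<in> X \<Longrightarrow> length (lab b) \<le> length (lab x)"
  shows "prefix (lab b) (lab x)"
proof -
  have "(b, x) \<in> (steps G X)\<^sup>*" using assms by (auto simp: connected_in_def)
  then show ?thesis
  proof (induction rule: rtrancl_induct)
    case (step y z)
    then have yz: "adj G y z" "z \<in> X" by (auto simp: steps_def)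
    from comparable[OF yz(1)] show ?case
    proof
      assume "prefix (lab y) (lab z)"
      then show ?thesis using step.IH by (meson prefix_order.trans)
    next
      assume "prefix (lab z) (lab y)"
      then show ?thesis using step.IH assms(4)[OF yz(2)] prefix_length_prefix by metis
    qed
  qed simp
qed

lemma ancestors_prefix: 
  assumes "a \<in> ancestors X u" "X \<subseteq> verts G" "u \<in> X"
  shows "prefix (lab a) (lab u)"
proof -
  have "a \<in> X \<inter> below (lab a)" using assms by (auto simp: ancestors_def below_def)
  then have "u \<in> X \<inter> below (lab a)" using steps_mem assms(1) unfolding ancestors_def by fast
  then show ?thesis by (simp add: below_def)
qed

lemma self_ancestor: "u \<in> X \<Longrightarrow> u \<in> ancestors X u"
  by (simp add: ancestors_def)

text \<open>Here \<open>a\<close> is the lowest candidate at level at most \<open>l\<close>. The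
  part of \<open>X\<close> around \<open>u\<close> inside the subtree entered next is attached to
  \<open>a\<close> directly, because the vertex through which \<open>X\<close> leaves this part on
  the way to \<open>a\<close> is itself a candidate, hence equal to \<open>a\<close>.\<close>

lemma branch_piece:
  assumes X: "X \<subseteq> verts G" and uv: "adj G u v" "u \<in> X" "v \<in> X" "length (lab u) < length (lab v)"
    and a: "a \<in> ancestors X u" "length (lab a) \<le> l" and l: "l < length (lab v)"
    and max: "\<And>a'. a' \<in> ancestors X u \<Longrightarrow> length (lab a') \<le> l \<Longrightarrow> length (lab a') \<le> length (lab a)"
  shows "\<exists>D \<subseteq> X \<inter> below (take (Suc l) (lab v)).
    v \<in> D \<and> connected_in G (insert a D) \<and> u \<in> insert a D \<and> a \<notin> D \<and> (\<exists>y\<in>D. adj G a y)"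
proof (cases "length (lab u) \<le> l")
  \<comment> \<open>If \<open>u\<close> has level at most \<open>l\<close>, the lowest candidate is
    \<open>u\<close> itself, and \<open>v\<close> alone makes up the piece.\<close>
  case True
  have "length (lab u) \<le> length (lab a)" using max[OF self_ancestor[OF uv(2)] True] .
  moreover have "prefix (lab a) (lab u)" using ancestors_prefix[OF a(1) X uv(2)] .
  ultimately have "lab a = lab u" by (auto simp: prefix_def)
  moreover have "a \<in> X" using a by (simp add: ancestors_def)
  ultimately have au: "a = u" using X uv inj by (meson inj_onD subsetD)
  have "connected_in G (insert u {v})"
    by (rule connected_insert[of _ _ v]) (use uv in \<open>auto simp: connected_in_def\<close>)
  then show ?thesis
    using uv X au adj_verts(3)[OF uv(1)] by (intro exI[of _ "{v}"]) (auto simp: below_def take_is_prefix)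
next
  case False
  define z where "z = take (Suc l) (lab v)"
  define Y where "Y = X \<inter> below z"
  define D where "D = {y. (u, y) \<in> (steps G Y)\<^sup>*}"
  have lz: "length z = Suc l" using l by (simp add: z_def)
  have pzv: "prefix z (lab v)" by (simp add: z_def take_is_prefix)
  have puv: "prefix (lab u) (lab v)" using adj_length_prefix uv by simp
  have pzu: "prefix z (lab u)" using prefix_length_prefix[OF pzv puv] False lz by simp
  have uY: "u \<in> Y" and vY: "v \<in> Y" using uv X pzu pzv by (auto simp: Y_def below_def)
  have DY: "D \<subseteq> Y" using steps_mem[OF _ uY] by (auto simp: D_def)
  have uD: "u \<in> D" by (simp add: D_def)
  have vD: "v \<in> D" using uY vY uv by (auto simp: D_def steps_def)
  have Dclosed: "y' \<in> D" if "y \<in> D" "y' \<in> Y" "adj G y y'" for y y'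
  proof -
    have "(y, y') \<in> steps G Y" using that DY by (auto simp: steps_def)
    then show ?thesis using that(1) by (auto simp: D_def intro: rtrancl_into_rtrancl)
  qed
  have inner: "(u, y) \<in> (steps G D)\<^sup>*" if "y \<in> D" for y
    using that steps_component unfolding D_def by simp
  have conD: "connected_in G D" unfolding D_def by (rule connected_component)
  have aX: "a \<in> X" "a \<in> verts G" using a X by (auto simp: ancestors_def)
  have aD: "a \<notin> D"
  proof
    assume "a \<in> D"
    then have "prefix z (lab a)" using DY by (auto simp: Y_def below_def)
    then show False using a(2) lz by (auto dest: prefix_length_le)
  qed
  \<comment> \<open>\<open>X\<close> connects \<open>u\<close> to \<open>a\<close> inside the
    subtree of \<open>a\<close>. As \<open>a\<close> is not in \<open>D\<close>, the connection
    leaves \<open>D\<close> somewhere; \<open>c\<close> is the vertex just outside.\<close>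
  define Z where "Z = X \<inter> below (lab a)"
  have "(u, a) \<in> (steps G Z)\<^sup>*" using a(1) steps_sym unfolding ancestors_def Z_def by fast
  then have "a \<notin> D \<longrightarrow> (\<exists>c y. c \<in> Z \<and> c \<notin> D \<and> y \<in> D \<and> adj G c y)"
    by (induction rule: rtrancl_induct) (use uD in \<open>auto simp: steps_def, metis adj_commute\<close>)
  then obtain c y where c: "c \<in> Z" "c \<notin> D" "y \<in> D" "adj G c y" using aD by blast
  have cX: "c \<in> X" "c \<in> verts G" and pac: "prefix (lab a) (lab c)" using c X by (auto simp: Z_def below_def)
  have "c \<notin> Y" using Dclosed[of y c] c by (auto simp: adj_commute)
  then have ncz: "\<not> prefix z (lab c)" using cX by (simp add: Y_def below_def)
  have pzy: "prefix z (lab y)" using c DY by (auto simp: Y_def below_def)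
  \<comment> \<open>\<open>c\<close> is adjacent to a vertex below \<open>z\<close> without lying
    below \<open>z\<close>, so it is a proper ancestor of that node.\<close>
  have pcz: "prefix (lab c) z"
  proof -
    have "prefix (lab c) (lab y)"
      using comparable[OF c(4)] ncz pzy by (meson prefix_order.trans)
    then show ?thesis using pzy ncz by (meson prefix_same_cases)
  qed
  then have "length (lab c) \<noteq> Suc l" using ncz lz by (auto simp: prefix_def)
  then have cl: "length (lab c) \<le> l" using pcz lz by (auto dest: prefix_length_le)
  define C where "C = X \<inter> below (lab c)"
  have DC: "D \<subseteq> C" using DY pcz unfolding C_def Y_def below_def by (auto intro: prefix_order.trans)
  have "c \<in> C" using cX by (simp add: C_def below_def)
  then have "(c, y) \<in> steps G C" using c DC by (auto simp: steps_def)
  moreover have "(y, u) \<in> (steps G C)\<^sup>*" using steps_mono[OF DC inner[OF c(3)]] steps_sym by fast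
  \<comment> \<open>Passing through \<open>D\<close>, \<open>c\<close> reaches \<open>u\<close>
    inside its own subtree. So it is a candidate of level at most \<open>l\<close>, and maximality
    of \<open>a\<close> forces \<open>c = a\<close>.\<close>
  ultimately have "c \<in> ancestors X u"
    using cX unfolding ancestors_def C_def by (auto intro: converse_rtrancl_into_rtrancl)
  then have "length (lab c) \<le> length (lab a)" using max cl by blast
  then have "lab c = lab a" using pac by (auto simp: prefix_def)
  then have "c = a" using inj cX aX by (auto dest: inj_onD)
  then show ?thesis
    using connected_insert[OF conD c(3)] c DY vD uD aD unfolding Y_def z_def
    by (intro exI[of _ D]) auto
qed

lemma finite_branches: "finite (branches l w)"
proof (rule finite_subset)
  show "branches l w \<subseteq> (\<lambda>y. lab y ! length w) ` verts G"
  proof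
    fix x assume "x \<in> branches l w"
    then obtain a y where "adj G a y" "prefix (w @ [x]) (lab y)" by (auto simp: branches_def)
    then show "x \<in> (\<lambda>y. lab y ! length w) ` verts G"
      using adj_verts(2) by (intro image_eqI[of _ _ y]) (auto simp: prefix_def nth_append)
  qed
qed (simp add: finite_verts)

lemma cert_exists:
  assumes core: "core G k e X"
  shows "\<exists>u v b q D J. e = {u, v} \<and> cert k u v b q D J"
proof -
  have X: "X \<subseteq> verts G" "connected_in G X" "acyclic_in G X" "e \<subseteq> X" and cardX: "k + 1 \<le> card X"
    and "e \<in> edges G" using core by (auto simp: core_def)
  have finX: "finite X" using X(1) finite_verts finite_subset by blast
  obtain u v where e: "e = {u, v}" and uv: "adj G u v" "length (lab u) < length (lab v)"
    using oriented_edge[OF \<open>e \<in> edges G\<close>] by blast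
  have uX: "u \<in> X" and vX: "v \<in> X" using X e by auto
  define n where "n = length (lab v)"
  have puv: "prefix (lab u) (lab v)" using adj_length_prefix uv by simp
  define B where "B = ancestors X u"
  have BX: "B \<subseteq> X" by (auto simp: B_def ancestors_def)
  have finB: "finite B" using BX finX finite_subset by blast
  have uB: "u \<in> B" using self_ancestor[OF uX] by (simp add: B_def)
  have Bu: "prefix (lab a) (lab u)" if "a \<in> B" for a
    using ancestors_prefix[OF _ X(1) uX] that by (simp add: B_def)
  have Bv: "prefix (lab a) (lab v)" if "a \<in> B" for a
    using Bu[OF that] puv by (rule prefix_order.trans)
  have Bn: "length (lab a) < n" if "a \<in> B" for a
    using Bu[OF that] uv(2) by (auto simp: n_def dest: prefix_length_le)
  obtain b0 where b0: "b0 \<in> X" "\<And>x. x \<in> X \<Longrightarrow> length (lab b0) \<le> length (lab x)"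
    using ex_has_least_nat[of "\<lambda>x. x \<in> X" u "\<lambda>x. length (lab x)"] uX by blast
  have top: "prefix (lab b0) (lab x)" if "x \<in> X" for x
    using connected_below_top[OF X(2) b0(1) that b0(2)] .
  have "X \<inter> below (lab b0) = X" using top X(1) by (auto simp: below_def)
  then have b0B: "b0 \<in> B" using X(2) b0 uX by (simp add: B_def ancestors_def connected_in_def)
  define p where "p = length (lab b0)"
  \<comment> \<open>From level \<open>p\<close> on, the top \<open>b0\<close> shows that there is a
    candidate at all, so a lowest one can be chosen as \<open>\<beta> l\<close>.\<close>
  have "\<exists>a. a \<in> B \<and> length (lab a) \<le> l \<and> (\<forall>a'\<in>B. length (lab a') \<le> l \<longrightarrow> length (lab a') \<le> length (lab a))"
    if "p \<le> l" for l
    using ex_has_greatest_nat[of "\<lambda>a. a \<in> B \<and> length (lab a) \<le> l" b0 "\<lambda>a. length (lab a)" "Suc l"]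
      b0B that by (auto simp: p_def less_Suc_eq_le)
  then obtain \<beta> where \<beta>: "\<And>l. p \<le> l \<Longrightarrow> \<beta> l \<in> B" "\<And>l. p \<le> l \<Longrightarrow> length (lab (\<beta> l)) \<le> l"
    "\<And>l a. p \<le> l \<Longrightarrow> a \<in> B \<Longrightarrow> length (lab a) \<le> l \<Longrightarrow> length (lab a) \<le> length (lab (\<beta> l))"
    by metis
  have piece: "\<exists>D \<subseteq> X \<inter> below (take (Suc l) (lab v)).
      v \<in> D \<and> connected_in G (insert (\<beta> l) D) \<and> u \<in> insert (\<beta> l) D \<and> \<beta> l \<notin> D \<and> (\<exists>y\<in>D. adj G (\<beta> l) y)"
    if "p \<le> l" "l < n" for l
  proof (rule branch_piece[OF X(1) uv(1) uX vX uv(2)])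
    show "length (lab a') \<le> length (lab (\<beta> l))" if "a' \<in> ancestors X u" "length (lab a') \<le> l" for a'
      using \<beta>(3)[OF \<open>p \<le> l\<close>] that by (simp add: B_def)
  qed (use \<beta>[OF that(1)] that in \<open>auto simp: B_def n_def\<close>)
  define K where "K l = branches (lab (\<beta> l)) (take l (lab v))" for l
  have letter: "lab v ! l \<in> K l" if l: "p \<le> l" "l < n" for l
  proof -
    obtain y where "adj G (\<beta> l) y" "y \<in> below (take (Suc l) (lab v))" using piece[OF l] by blast
    then show ?thesis using l(2) unfolding K_def branches_def below_def n_def
      by (auto simp: take_Suc_conv_app_nth)
  qed
  \<comment> \<open>The level \<open>n\<close> of \<open>v\<close> is added so that
    \<open>J b\<close> records it as its maximum. From the level of \<open>b\<close> up to
    \<open>n - 1\<close>, the maximum of \<open>J b\<close> up to \<open>l\<close> is still the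
    level of \<open>\<beta> l\<close>.\<close>
  define J where "J b = {length (lab a) | a. a \<in> B \<and> length (lab b) \<le> length (lab a)} \<union> {n}" for b
  have finJ: "finite (J b)" for b using finB by (simp add: J_def)
  have Jmax: "Max (J b \<inter> {..l}) = length (lab (\<beta> l))" if "b \<in> B" "length (lab b) \<le> l" "l < n" for b l
  proof (rule Max_eqI)
    have pl: "p \<le> l" using b0(2)[of b] that BX by (auto simp: p_def)
    show "length (lab (\<beta> l)) \<in> J b \<inter> {..l}" using \<beta>[OF pl] that by (auto simp: J_def)
    fix j assume "j \<in> J b \<inter> {..l}"
    then show "j \<le> length (lab (\<beta> l))" using \<beta>(3)[OF pl] that by (auto simp: J_def)
  qed (use finJ in auto)
  \<comment> \<open>All candidates are ancestors of \<open>u\<close>, so \<open>u\<close> is the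
    lowest one.\<close>
  have Jmax_u: "Max (J b \<inter> {..<n}) = length (lab u)" if "b \<in> B" for b
  proof (rule Max_eqI)
    show "length (lab u) \<in> J b \<inter> {..<n}" using uB that Bu Bn by (auto simp: J_def dest: prefix_length_le)
    fix j assume "j \<in> J b \<inter> {..<n}"
    then show "j \<le> length (lab u)" using Bu by (auto simp: J_def dest: prefix_length_le)
  qed (use finJ in auto)
  have J: "J b \<subseteq> {length (lab b)..n}" "length (lab b) \<in> J b" "n \<in> J b" if "b \<in> B" for b
    using that Bn[OF that] by (auto simp: J_def dest: Bn)
  have take_lab: "take (length (lab a)) (lab v) = lab a" if "a \<in> B" for a
    using Bv[OF that] by (auto simp: prefix_def)
  have grownX: "grown G b D" if "connected_in G D" "D \<subseteq> X" "b \<in> D" for b D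
    using grownI[OF that(1) acyclic_in_subset[OF X(3) that(2)] finite_subset[OF that(2) finX] that(3)] .
  have poor: "lab v ! l \<in> branches (take (Max (J b \<inter> {..l})) (lab v)) (take l (lab v)) \<and>
        card (branches (take (Max (J b \<inter> {..l})) (lab v)) (take l (lab v))) < k"
    if "b \<in> B" "length (lab b) \<le> l" "l < n" "card (K l) < k" for b l
  proof -
    have pl: "p \<le> l" using b0(2)[of b] that BX by (auto simp: p_def)
    show ?thesis using letter[OF pl that(3)] that(4) take_lab[OF \<beta>(1)[OF pl]]
      by (simp add: Jmax[OF that(1-3)] K_def)
  qed
  show ?thesis
  proof (cases "\<exists>l. p \<le> l \<and> l < n \<and> k \<le> card (K l)")
    case True
    \<comment> \<open>By maximality every level between \<open>m\<close> and that of
      \<open>v\<close> has fewer than \<open>k\<close> branches. The piece hangs from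
      \<open>\<beta> m\<close>, and \<open>q\<close> becomes \<open>Suc m\<close>, the level of the
      node where it starts.\<close>
    define m where "m = Max {l. p \<le> l \<and> l < n \<and> k \<le> card (K l)}"
    have fin: "finite {l. p \<le> l \<and> l < n \<and> k \<le> card (K l)}" by simp
    have m: "p \<le> m" "m < n" "k \<le> card (K m)"
      using Max_in[OF fin] True unfolding m_def[symmetric] by auto
    have m_max: "card (K l) < k" if "m < l" "l < n" for l
    proof (rule ccontr)
      assume "\<not> card (K l) < k"
      then have "l \<le> m" unfolding m_def using that m by (intro Max_ge[OF fin]) auto
      then show False using that by simp
    qed
    define b where "b = \<beta> m"
    have b: "b \<in> B" "length (lab b) \<le> m" using \<beta> m by (auto simp: b_def)
    obtain D where D: "D \<subseteq> X" "D \<subseteq> below (take (Suc m) (lab v))"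
      "v \<in> D" "connected_in G (insert b D)" "u \<in> insert b D" "b \<notin> D"
      using piece[OF m(1,2)] unfolding b_def by blast
    have "grown G b (insert b D)" using grownX[OF D(4)] D b BX by auto
    moreover have "b \<in> verts G" using b BX X by auto
    ultimately have "cert k u v b (Suc m) D (J b)"
      unfolding cert_def n_def[symmetric]
      using uv b D J[OF b(1)] Jmax_u[OF b(1)] Bv[OF b(1)] m poor[OF b(1)] m_max letter[OF m(1,2)]
      by (auto simp: K_def n_def b_def)
    then show ?thesis using e by blast
  next
    case False
    then have all: "card (K l) < k" if "p \<le> l" "l < n" for l using that by force
    \<comment> \<open>All of \<open>X\<close> is kept and hangs from its top; with
      \<open>q = p\<close> the certificate asks for \<open>k\<close> vertices besides
      \<open>b0\<close>.\<close>
    define D where "D = X - {b0}"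
    have iD: "insert b0 D = X" using b0 by (auto simp: D_def)
    have "card D = card X - 1" using b0 finX by (simp add: D_def)
    then have "k \<le> card D" using cardX by simp
    moreover have "D \<subseteq> below (lab b0)" using top X by (auto simp: D_def below_def)
    moreover have "v \<noteq> b0" using uv(2) b0(2)[OF uX] by auto
    then have "v \<in> D" using vX by (simp add: D_def)
    moreover have "b0 \<notin> D" by (simp add: D_def)
    ultimately have "cert k u v b0 p D (J b0)"
      unfolding cert_def n_def[symmetric] iD p_def[symmetric]
      using uv J[OF b0B] Jmax_u[OF b0B] Bv[OF b0B] poor[OF b0B] all grownX[OF X(2)] b0 uX X(1)
        take_lab[OF b0B] Bn[OF b0B]
      by (auto simp: n_def p_def)
    then show ?thesis using e by blast
  qed
qed

end

section \<open>Strong forests as unions of trees\<close>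

lemma is_path_induced: "is_path (induced_subgraph G X) p \<longleftrightarrow> path_in G X p"
proof -
  have "successively (\<lambda>u v. {u, v} \<in> edges (induced_subgraph G X)) p \<longleftrightarrow> successively (adj G) p"
    if "set p \<subseteq> X"
    by (rule successively_cong) (use that in \<open>auto simp: induced_subgraph_def adj_def\<close>)
  then show ?thesis by (auto simp: is_path_def path_in_def induced_subgraph_def)
qed

lemma acyclic_induced: "acyclic_graph (induced_subgraph G X) \<longleftrightarrow> acyclic_in G X"
proof -
  have "is_cycle (induced_subgraph G X) p \<longleftrightarrow> path_in G X p \<and> length p \<ge> 3 \<and> adj G (last p) (hd p)" for p
    unfolding is_cycle_def is_path_induced
    by (auto simp: induced_subgraph_def adj_def path_in_def)
  then show ?thesis by (simp add: acyclic_graph_def acyclic_in_def)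
qed

lemma joined_induced: "joined (induced_subgraph G X) u v \<longleftrightarrow> u \<in> X \<and> (u, v) \<in> (steps G X)\<^sup>*"
  by (simp add: joined_def is_path_induced ex_path_in)

text \<open>The component containing \<open>e\<close> is an induced tree with at least
  \<open>k\<close> edges. It is replaced by a subtree around \<open>e\<close> with exactly
  \<open>k + 1\<close> vertices, as the count over sets of levels requires.\<close>

lemma valid_edge_core:
  assumes G: "simple_graph G" and k: "k \<ge> 1" and "valid_edge k G e"
  shows "\<exists>X. core G k e X \<and> card X = k + 1"
proof -
  obtain F where F: "strong_forest k G F" "e \<in> edges F" and eG: "e \<in> edges G"
    using assms(3) by (auto simp: valid_edge_def)
  then obtain S where S: "S \<subseteq> verts G" "F = induced_subgraph G S" "acyclic_in G S"
    by (auto simp: strong_forest_def induced_forest_def acyclic_induced)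
  have eS: "e \<subseteq> S" using F S by (simp add: induced_subgraph_def)
  obtain u v where uv: "e = {u, v}" "adj G u v" "u \<noteq> v" using edge_endpoints[OF G eG] by auto
  define Y where "Y = {w. (u, w) \<in> (steps G S)\<^sup>*}"
  have uS: "u \<in> S" "v \<in> S" using eS uv by auto
  have YS: "Y \<subseteq> S" using steps_mem[OF _ uS(1)] by (auto simp: Y_def)
  have finY: "finite Y" using YS S(1) G by (meson simple_graph_def finite_subset)
  have uY: "u \<in> Y" "v \<in> Y" using uS uv by (auto simp: Y_def steps_def)
  have conY: "connected_in G Y" unfolding Y_def by (rule connected_component)
  have acY: "acyclic_in G Y" by (rule acyclic_in_subset[OF S(3) YS])
  have "induced_subgraph F {w. joined F u w} \<in> components F"
    using uS by (auto simp: components_def S induced_subgraph_def)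
  then have "card (edges (induced_subgraph F {w. joined F u w})) \<ge> k"
    using F(1) by (simp add: strong_forest_def)
  also have "edges (induced_subgraph F {w. joined F u w}) = {e \<in> edges G. e \<subseteq> Y}"
    using YS uS by (auto simp: S(2) joined_induced Y_def[symmetric]) (auto simp: induced_subgraph_def Y_def)
  finally have "k + 1 \<le> card Y"
    using grown_card_edges[OF G grownI[OF conY acY finY uY(1)]] by simp
  moreover have "connected_in G (insert u {v})"
    by (rule connected_insert[of _ _ v]) (use uv in \<open>auto simp: connected_in_def\<close>)
  ultimately obtain X where X: "{u, v} \<subseteq> X" "X \<subseteq> Y" "connected_in G X" "card X = k + 1"
    using connected_subset_of_card[OF conY finY, of "{u, v}" "k + 1"] uY k uv(3) by auto
  then have "core G k e X"
    using eG uv YS S acyclic_in_subset[OF acY X(2)] by (auto simp: core_def)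
  then show ?thesis using X by blast
qed

lemma path_in_closed:
  assumes "path_in G S p" "hd p \<in> T" "\<And>x y. x \<in> T \<Longrightarrow> y \<in> S \<Longrightarrow> adj G x y \<Longrightarrow> y \<in> T"
  shows "set p \<subseteq> T"
  using assms(1,2)
proof (induction p)
  case (Cons a p)
  show ?case
  proof (cases p)
    case Nil
    then show ?thesis using Cons.prems by simp
  next
    case (Cons b q)
    then have "path_in G S p" "adj G a b" "b \<in> S" using Cons.prems by (auto simp: path_in_def)
    then show ?thesis using Cons.IH Cons Cons.prems(2) assms(3)[of a b] by auto
  qed
qed simp

text \<open>No edge runs between two of the trees, so each is closed under adjacency in the union:
  cycles stay inside one tree, and the components are exactly the trees.\<close>

lemma strong_forest_union:
  assumes G: "simple_graph G"
    and T: "\<And>r. r \<in> R \<Longrightarrow> grown G r (T r) \<and> T r \<subseteq> verts G \<and> k + 1 \<le> card (T r)"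
    and sep: "\<And>r r' x y. r \<in> R \<Longrightarrow> r' \<in> R \<Longrightarrow> r \<noteq> r' \<Longrightarrow> x \<in> T r \<Longrightarrow> y \<in> T r' \<Longrightarrow> x \<noteq> y \<and> \<not> adj G x y"
  shows "strong_forest k G (induced_subgraph G (\<Union>r\<in>R. T r))"
proof -
  define S where "S = (\<Union>r\<in>R. T r)"
  have closed: "y \<in> T r" if "r \<in> R" "x \<in> T r" "y \<in> S" "adj G x y" for r x y
    using that sep[of r _ x y] by (auto simp: S_def)
  have "acyclic_in G S"
    unfolding acyclic_in_def
  proof safe
    fix p assume p: "path_in G S p" "length p \<ge> 3" "adj G (last p) (hd p)"
    then obtain r where r: "r \<in> R" "hd p \<in> T r" by (cases p) (auto simp: path_in_def S_def)
    have "set p \<subseteq> T r" by (rule path_in_closed[OF p(1) r(2)]) (rule closed[OF r(1)])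
    then have "path_in G (T r) p" using p(1) by (simp add: path_in_def)
    moreover have "acyclic_in G (T r)" using T[OF r(1)] by (intro grown_acyclic[of G r]) simp
    ultimately show False using p unfolding acyclic_in_def by blast
  qed
  moreover have "S \<subseteq> verts G" using T by (auto simp: S_def)
  moreover have "k \<le> card (edges C)" if "C \<in> components (induced_subgraph G S)" for C
  proof -
    let ?F = "induced_subgraph G S"
    obtain u where u: "u \<in> S" "C = induced_subgraph ?F {v. joined ?F u v}"
    proof -
      have "verts ?F = S" by (simp add: induced_subgraph_def)
      then show thesis using that \<open>C \<in> components ?F\<close> unfolding components_def by blast
    qed
    obtain r where r: "r \<in> R" "u \<in> T r" using u by (auto simp: S_def)
    have TS: "T r \<subseteq> S" using r by (auto simp: S_def)
    have "{v. joined ?F u v} = T r"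
    proof safe
      fix v assume "joined ?F u v"
      then have "(u, v) \<in> (steps G S)\<^sup>*" by (simp add: joined_induced)
      then show "v \<in> T r"
        by (induction rule: rtrancl_induct) (use r closed[OF r(1)] in \<open>auto simp: steps_def\<close>)
    next
      fix v assume "v \<in> T r"
      then have "(u, v) \<in> (steps G (T r))\<^sup>*"
        using grown_connected[of G r "T r"] T[OF r(1)] r(2) by (auto simp: connected_in_def)
      then show "joined ?F u v" using steps_mono[OF TS] u(1) by (auto simp: joined_induced)
    qed
    then have "edges C = {e \<in> edges G. e \<subseteq> T r}" using TS unfolding u(2) by (auto simp: induced_subgraph_def)
    then show ?thesis using grown_card_edges[OF G] T[OF r(1)] by fastforce
  qed
  ultimately show ?thesis
    unfolding strong_forest_def induced_forest_def S_def[symmetric] acyclic_induced by blast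
qed

section \<open>Separated subtrees and trees glued at a common root\<close>

context labelled_graph
begin

text \<open>Adjacent vertices have comparable labels, so an edge would put one endpoint below both
  nodes; but a list has only one prefix of each length.\<close>

lemma below_separated:
  assumes "length z = length z'" "z \<noteq> z'" "x \<in> below z" "y \<in> below z'"
  shows "x \<noteq> y \<and> \<not> adj G x y"
proof -
  have p: "prefix z (lab x)" "prefix z' (lab y)" using assms by (auto simp: below_def)
  have eq: "z = z'" if "prefix z w" "prefix z' w" for w
    using that assms(1) by (metis prefix_def append_eq_append_conv)
  have "\<not> adj G x y"
  proof
    assume "adj G x y"
    then have "prefix z (lab y) \<or> prefix z' (lab x)" 
      using comparable p prefix_order.trans by metis
    then show False using eq p assms(2) by blast
  qed
  then show ?thesis using eq p assms(2) by blast
qed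

lemma grown_union:
  assumes "finite Z"
    and "\<And>z. z \<in> Z \<Longrightarrow> grown G b (insert b (D z)) \<and> b \<notin> D z \<and> D z \<subseteq> below z \<and> length z = q"
  shows "grown G b (insert b (\<Union>z\<in>Z. D z))"
  using assms
proof (induction Z rule: finite_induct)
  case empty
  then show ?case by (simp add: grown.root)
next
  case (insert z Z)
  have 1: "grown G b (insert b (\<Union>z\<in>Z. D z))" using insert by blast
  have z: "grown G b (insert b (D z))" "b \<notin> D z" "D z \<subseteq> below z" "length z = q"
    using insert.prems by blast+
  have "grown G b (insert b (\<Union>z\<in>Z. D z) \<union> insert b (D z))"
  proof (rule grown_glue[OF 1 z(1)])
    fix x y assume x: "x \<in> insert b (\<Union>z\<in>Z. D z) - {b}" and y: "y \<in> insert b (D z) - {b}"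
    then obtain z' where z': "z' \<in> Z" "x \<in> D z'" by auto
    then have "length z' = q" "D z' \<subseteq> below z'" using insert.prems by blast+
    then show "x \<noteq> y \<and> \<not> adj G x y"
      using below_separated[of z' z x y] z' z y insert.hyps(2) by auto
  qed
  then show ?case by (simp add: Un_commute)
qed

text \<open>Subtrees of nodes at one level are disjoint, so one vertex picked from each gives an
  injection.\<close>

lemma card_union_ge:
  assumes "finite (\<Union>z\<in>Z. D z)" and "\<And>z. z \<in> Z \<Longrightarrow> D z \<noteq> {} \<and> D z \<subseteq> below z \<and> length z = q"
  shows "card Z \<le> card (\<Union>z\<in>Z. D z)"
proof -
  define f where "f z = (SOME x. x \<in> D z)" for z
  have f: "f z \<in> D z" if "z \<in> Z" for z
    using assms(2)[OF that] unfolding f_def by (simp add: some_in_eq)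
  have "inj_on f Z"
  proof (rule inj_onI)
    fix z z' assume zz: "z \<in> Z" "z' \<in> Z" "f z = f z'"
    then have "f z \<in> below z" "f z \<in> below z'" "length z = length z'" using f assms(2) by force+
    then show "z = z'" using below_separated[of z z' "f z" "f z"] by blast
  qed
  moreover have "f ` Z \<subseteq> (\<Union>z\<in>Z. D z)" using f by blast
  ultimately show ?thesis by (rule card_inj_on_le[OF _ _ assms(1)])
qed

end

section \<open>The forest of a class of edges\<close>

text \<open>Any numbering will do, but it depends on the set alone: edges that see the same branches
  number them alike.\<close>

definition rank :: "'b set \<Rightarrow> 'b \<Rightarrow> nat" where
  "rank K = (SOME f. bij_betw f K {..<card K})"

lemma rank_bij:
  assumes "finite K"
  shows "bij_betw (rank K) K {..<card K}"
  unfolding rank_def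
proof (rule someI_ex[of "\<lambda>f. bij_betw f K {..<card K}"])
  show "\<exists>f. bij_betw f K {..<card K}"
    using ex_bij_betw_finite_nat[OF assms] by (simp add: atLeast0LessThan)
qed

lemma rank_less: "finite K \<Longrightarrow> x \<in> K \<Longrightarrow> rank K x < card K"
  using rank_bij by (fastforce simp: bij_betw_def)

lemma rank_inj: "finite K \<Longrightarrow> x \<in> K \<Longrightarrow> y \<in> K \<Longrightarrow> rank K x = rank K y \<Longrightarrow> x = y"
  using rank_bij by (meson bij_betw_def inj_onD)

context labelled_graph
begin

text \<open>The second component of the function assigned to an edge, at level \<open>l\<close>. An index is less than
  \<open>k - 1\<close>, as it counts a branch among fewer than \<open>k\<close>.\<close>
definition num :: "nat \<Rightarrow> 'a \<Rightarrow> 'a \<Rightarrow> nat \<Rightarrow> nat set \<Rightarrow> nat \<Rightarrow> nat" where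
  "num k v b q J l =
    (if q \<le> l \<and> l < length (lab v)
     then rank (branches (take (Max (J \<inter> {..l})) (lab v)) (take l (lab v))) (lab v ! l)
     else if q \<noteq> length (lab b) \<and> Suc l = q then k - 1 else 0)"

text \<open>Membership in \<open>J\<close> and \<open>num\<close> together form the function on the
  \<open>d\<close> levels; the relation says that two edges receive the same one.\<close>

definition compatible where
  "compatible k v b q J v' b' q' J' \<longleftrightarrow>
     (\<forall>l\<in>{1..d}. (l \<in> J \<longleftrightarrow> l \<in> J') \<and> num k v b q J l = num k v' b' q' J' l)"

lemma compatible_sym: "compatible k v b q J v' b' q' J' \<Longrightarrow> compatible k v' b' q' J' v b q J"
  by (simp add: compatible_def)

lemma cert_bounds:
  assumes "cert k u v b q D J"
  shows "u \<in> verts G" "v \<in> verts G" "b \<in> verts G" "1 \<le> length (lab b)" "length (lab v) \<le> d"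
    "length (lab b) \<le> q" "q \<le> length (lab v)"
    "J \<subseteq> {1..d}" "J \<subseteq> {length (lab b)..length (lab v)}" "length (lab b) \<in> J" "length (lab v) \<in> J"
proof -
  have "adj G u v" "b \<in> verts G" using assms by (auto simp: cert_def)
  then show v: "u \<in> verts G" "v \<in> verts G" "b \<in> verts G" using adj_verts by auto
  show b: "1 \<le> length (lab b)" "length (lab v) \<le> d"
    using nonempty[OF v(3)] length_le[OF v(2)] by (auto simp: Suc_le_eq)
  show "length (lab b) \<le> q" "q \<le> length (lab v)" using assms by (auto simp: cert_def)
  show J: "J \<subseteq> {length (lab b)..length (lab v)}" "length (lab b) \<in> J" "length (lab v) \<in> J"
    using assms by (auto simp: cert_def)
  show "J \<subseteq> {1..d}" using J(1) b by auto
qed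

lemma cert_letter:
  assumes "cert k u v b q D J" "q \<le> l" "l < length (lab v)"
  shows "lab v ! l \<in> branches (take (Max (J \<inter> {..l})) (lab v)) (take l (lab v))"
    "card (branches (take (Max (J \<inter> {..l})) (lab v)) (take l (lab v))) < k"
    "num k v b q J l + 1 < k"
proof -
  let ?K = "branches (take (Max (J \<inter> {..l})) (lab v)) (take l (lab v))"
  show 1: "lab v ! l \<in> ?K" "card ?K < k" using assms by (auto simp: cert_def)
  have "rank ?K (lab v ! l) < card ?K" using rank_less[OF finite_branches 1(1)] .
  then show "num k v b q J l + 1 < k" using 1 assms by (simp add: num_def)
qed

lemma num_less:
  assumes "cert k u v b q D J" "k \<ge> 1" shows "num k v b q J l < k"
  using cert_letter(3)[OF assms(1), of l] assms(2) by (cases "q \<le> l \<and> l < length (lab v)") (auto simp: num_def)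

text \<open>The level of \<open>b\<close> is the least element of \<open>J\<close> and that of
  \<open>v\<close> the greatest.\<close>

lemma compatible_levels:
  assumes c: "cert k u v b q D J" "cert k u' v' b' q' D' J'" and s: "compatible k v b q J v' b' q' J'"
  shows "J = J'" "length (lab b) = length (lab b')" "length (lab v) = length (lab v')" 
proof -
  have "l \<in> J \<longleftrightarrow> l \<in> J'" for l
    using s cert_bounds(8)[OF c(1)] cert_bounds(8)[OF c(2)] by (auto simp: compatible_def)
  then show eq: "J = J'" by blast
  show "length (lab b) = length (lab b')" "length (lab v) = length (lab v')"
    using cert_bounds(9-11)[OF c(1)] cert_bounds(9-11)[OF c(2)] eq
    by (meson antisym atLeastAtMost_iff subsetD)+
qed

text \<open>If \<open>q < q'\<close>, then at level \<open>q' - 1\<close> the second edge has the mark \<open>k - 1\<close>, and the first one an index.\<close>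
lemma compatible_level_ge:
  assumes c: "cert k u v b q D J" "cert k u' v' b' q' D' J'" and s: "compatible k v b q J v' b' q' J'"
  shows "q' \<le> q"
proof (rule ccontr)
  assume "\<not> q' \<le> q"
  then have lt: "q < q'" by simp
  have eq: "J = J'" "length (lab b) = length (lab b')" "length (lab v) = length (lab v')"
    using compatible_levels[OF c s] by blast+
  note bd = cert_bounds[OF c(1)] cert_bounds[OF c(2)]
  have l: "q \<le> q' - 1" "q' - 1 < length (lab v)" "q' - 1 \<in> {1..d}" using lt bd eq by auto
  have "num k v b q J (q' - 1) = num k v' b' q' J' (q' - 1)" using s l(3) by (simp add: compatible_def)
  \<comment> \<open>Since \<open>q'\<close> exceeds \<open>q\<close>, which is at least the level of
    \<open>b\<close> and hence that of \<open>b'\<close>, the case with the mark applies to the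
    second edge.\<close>
  also have "\<dots> = k - 1" using lt bd eq by (auto simp: num_def)
  finally show False using cert_letter(3)[OF c(1) l(1,2)] by simp
qed

text \<open>The label of \<open>v\<close> is read off letter by letter from level \<open>q\<close>
  on: the known part and \<open>J\<close> determine the set of branches, and the index singles out
  the next letter. Finally, \<open>u\<close> is the ancestor of \<open>v\<close> at the last level
  of \<open>J\<close> before that of \<open>v\<close>.\<close>

lemma compatible_edge:
  assumes c: "cert k u v b q D J" "cert k u' v' b' q' D' J'" and s: "compatible k v b q J v' b' q' J'"
    and b: "b = b'" and start: "take q (lab v) = take q (lab v')"
  shows "u = u' \<and> v = v'"
proof -
  have eq: "J = J'" "length (lab b) = length (lab b')" "length (lab v) = length (lab v')"
    using compatible_levels[OF c s] by blast+
  have qq: "q = q'" using compatible_level_ge[OF c s] compatible_level_ge[OF c(2,1) compatible_sym[OF s]] by simp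
  note bd = cert_bounds[OF c(1)] cert_bounds[OF c(2)]
  have "take l (lab v) = take l (lab v')" if "q \<le> l" "l \<le> length (lab v)" for l
    using that
  proof (induction l rule: dec_induct)
    case base
    then show ?case using start by simp
  next
    case (step l)
    have IH: "take l (lab v) = take l (lab v')" and l: "l < length (lab v)" using step by auto
    define M where "M = Max (J \<inter> {..l})"
    have "length (lab b) \<in> J \<inter> {..l}" using bd step.hyps by auto
    then have "M \<in> J \<inter> {..l}" unfolding M_def by (intro Max_in) auto
    then have "M \<le> l" by simp
    \<comment> \<open>The branches depend on a vertex only through its label, here the prefix of
      length \<open>M\<close> of the known part.\<close>
    then have M: "take M (lab v) = take M (lab v')" using IH by (metis min.absorb1 take_take)
    have MJ: "Max (J \<inter> {..l}) = M" "Max (J' \<inter> {..l}) = M" using eq(1) by (simp_all add: M_def)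
    let ?K = "branches (take M (lab v)) (take l (lab v))"
    have "num k v b q J l = num k v' b' q' J' l"
      using s step.hyps l bd by (auto simp: compatible_def)
    then have "rank ?K (lab v ! l) = rank ?K (lab v' ! l)"
      using step.hyps l eq(3) qq M IH by (simp add: num_def MJ)
    moreover have "lab v ! l \<in> ?K" using cert_letter(1)[OF c(1) step.hyps(1) l] by (simp add: MJ)
    moreover have "lab v' ! l \<in> ?K"
      using cert_letter(1)[OF c(2), of l] step.hyps(1) l eq(3) qq M IH by (simp add: MJ)
    ultimately have "lab v ! l = lab v' ! l" using rank_inj[OF finite_branches] by blast
    then show ?case using IH l eq(3) by (simp add: take_Suc_conv_app_nth)
  qed
  from this[of "length (lab v)"] have "lab v = lab v'" using bd eq by simp
  then have v: "v = v'" using inj bd by (auto dest: inj_onD)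
  have "prefix (lab u) (lab v)" "prefix (lab u') (lab v)"
    using c v adj_length_prefix by (auto simp: cert_def)
  moreover have "length (lab u) = length (lab u')" using c eq by (auto simp: cert_def)
  ultimately have "u = u'" using prefix_lab_unique bd by blast
  then show ?thesis using v by simp
qed

lemma class_forest:
  fixes u v b :: "'a set \<Rightarrow> 'a" and q :: "'a set \<Rightarrow> nat"
  assumes C: "\<And>e. e \<in> C \<Longrightarrow> e = {u e, v e} \<and> cert k (u e) (v e) (b e) (q e) (D e) (J e)"
    and fin: "finite C"
    and comp: "\<And>e e'. e \<in> C \<Longrightarrow> e' \<in> C \<Longrightarrow> compatible k (v e) (b e) (q e) (J e) (v e') (b e') (q e') (J e')"
  shows "\<exists>F. strong_forest k G F \<and> C \<subseteq> edges F"
proof (cases "C = {}")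
  case True
  have "strong_forest k G (induced_subgraph G (\<Union>r\<in>({} :: 'a set). {}))"
    by (rule strong_forest_union[OF simple, where R = "{}" and T = "\<lambda>_. {}"]) auto
  then show ?thesis using True by blast
next
  case False
  then obtain e0 where e0: "e0 \<in> C" by blast
  define Q where "Q = q e0"
  define P where "P = length (lab (b e0))"
  have qP: "q e = Q" "length (lab (b e)) = P" if "e \<in> C" for e
    using compatible_level_ge[OF C[THEN conjunct2] C[THEN conjunct2] comp, OF that e0 that e0]
      compatible_level_ge[OF C[THEN conjunct2] C[THEN conjunct2] comp, OF e0 that e0 that]
      compatible_levels(2)[OF C[THEN conjunct2] C[THEN conjunct2] comp, OF that e0 that e0]
    by (auto simp: Q_def P_def)
  define anchor where "anchor e = take Q (lab (v e))" for e
  \<comment> \<open>The nodes at level \<open>Q\<close> whose subtrees are needed for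
    \<open>e\<close>: its own one if the tree hangs whole from its top, otherwise all at least
    \<open>k\<close> children that offer a neighbour of \<open>b e\<close>.\<close>
  define tops where "tops e = (if Q = P then {anchor e}
    else (\<lambda>x. take (Q - 1) (lab (v e)) @ [x]) ` branches (lab (b e)) (take (Q - 1) (lab (v e))))" for e
  define ok where "ok r z A \<longleftrightarrow> grown G r (insert r A) \<and> r \<notin> A \<and> A \<noteq> {} \<and> A \<subseteq> below z" for r z A
  have ok_D: "ok (b e) (anchor e) (D e)" if "e \<in> C" for e
    using C[OF that] qP[OF that] by (auto simp: ok_def cert_def anchor_def)
  have cb: "b e \<in> verts G" "P \<le> Q" "Q \<le> length (lab (v e))" "prefix (lab (b e)) (anchor e)" if "e \<in> C" for e
  proof -
    have c: "cert k (u e) (v e) (b e) (q e) (D e) (J e)" using C[OF that] by blast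
    then show 1: "b e \<in> verts G" "P \<le> Q" "Q \<le> length (lab (v e))"
      using qP[OF that] cert_bounds[OF c] by auto
    have "prefix (lab (b e)) (lab (v e))" using c by (auto simp: cert_def)
    then show "prefix (lab (b e)) (anchor e)" using 1 qP[OF that] unfolding anchor_def
      by (intro prefix_length_prefix[OF _ take_is_prefix]) auto
  qed
  have rich: "lab (v e) ! (Q - 1) \<in> branches (lab (b e)) (take (Q - 1) (lab (v e)))"
    "k \<le> card (branches (lab (b e)) (take (Q - 1) (lab (v e))))" if "e \<in> C" "Q \<noteq> P" for e
    using C[OF that(1)] qP[OF that(1)] that(2) by (auto simp: cert_def)
  have anchor_tops: "anchor e \<in> tops e" if e: "e \<in> C" for e
  proof (cases "Q = P")
    case False
    then have "Q \<ge> 1" using cb[OF e] by simp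
    then have "take (Q - 1) (lab (v e)) @ [lab (v e) ! (Q - 1)] = anchor e"
      using cb[OF e] take_Suc_conv_app_nth[of "Q - 1" "lab (v e)"] by (simp add: anchor_def)
    then show ?thesis using rich(1)[OF e False] False by (force simp: tops_def)
  qed (simp add: tops_def)
  have tops: "length z = Q" "prefix (lab (b e)) z" "\<exists>A. ok (b e) z A" "finite (tops e)"
    if e: "e \<in> C" and z: "z \<in> tops e" for e z
  proof -
    show "finite (tops e)" using finite_branches by (simp add: tops_def)
    have "length z = Q \<and> prefix (lab (b e)) z \<and> (\<exists>A. ok (b e) z A)"
    proof (cases "Q = P")
      case True
      then have "z = anchor e" using z by (simp add: tops_def)
      then show ?thesis using cb[OF e] ok_D[OF e] by (auto simp: anchor_def)
    next
      case False
      define w where "w = take (Q - 1) (lab (v e))"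
      obtain x where x: "x \<in> branches (lab (b e)) w" "z = w @ [x]"
        using z False by (auto simp: tops_def w_def)
      have lw: "length w + 1 = Q" using cb[OF e] False by (simp add: w_def)
      have "prefix (lab (b e)) (lab (v e))"
        using cb(4)[OF e] by (auto simp: anchor_def intro: prefix_order.trans take_is_prefix)
      then have "prefix (lab (b e)) w"
        using qP[OF e] cb(2)[OF e] False lw unfolding w_def
        by (intro prefix_length_prefix[OF _ take_is_prefix]) auto
      moreover obtain a y where y: "lab a = lab (b e)" "adj G a y" "prefix z (lab y)"
        using x by (auto simp: branches_def)
      have "a = b e" using inj y adj_verts(1) cb(1)[OF e] by (meson inj_onD)
      then have by': "adj G y (b e)" "y \<noteq> b e" "y \<in> verts G"
        using y(2) adj_verts adj_commute by metis+
      \<comment> \<open>One neighbour of \<open>b e\<close> inside the subtree is already an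
        admissible piece.\<close>
      have "grown G (b e) (insert y {b e})"
        by (rule grown.grow[OF grown.root _ _ by'(1)]) (use by' in auto)
      then have "ok (b e) z {y}" using by' y(3) by (auto simp: ok_def below_def insert_commute)
      ultimately show ?thesis using x(2) lw by auto
    qed
    then show "length z = Q" "prefix (lab (b e)) z" "\<exists>A. ok (b e) z A" by blast+
  qed
  define Z where "Z r = (\<Union>e\<in>{e\<in>C. b e = r}. tops e)" for r
  \<comment> \<open>The subtree of an anchor receives the tree of its edge, every other subtree an
    arbitrary admissible piece.\<close>
  define piece where "piece r z = (if \<exists>e\<in>C. b e = r \<and> anchor e = z then D (SOME e. e \<in> C \<and> b e = r \<and> anchor e = z)
     else (SOME A. ok r z A))" for r z
  have piece_ok: "ok r z (piece r z)" if "z \<in> Z r" for r z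
  proof (cases "\<exists>e\<in>C. b e = r \<and> anchor e = z")
    case True
    define s where "s = (SOME e. e \<in> C \<and> b e = r \<and> anchor e = z)"
    have s: "s \<in> C" "b s = r" "anchor s = z"
      using someI_ex[of "\<lambda>e. e \<in> C \<and> b e = r \<and> anchor e = z"] True unfolding s_def by blast+
    have "piece r z = D s" using True by (simp add: piece_def s_def)
    then show ?thesis using ok_D[OF s(1)] s by simp
  next
    case False
    have "\<exists>A. ok r z A" using that tops(3) by (auto simp: Z_def)
    then have "ok r z (SOME A. ok r z A)" by (rule someI_ex)
    then show ?thesis unfolding piece_def if_not_P[OF False] .
  qed
  \<comment> \<open>Edges of the class with the same top and the same anchor coincide, so the choice
    in \<open>piece\<close> returns \<open>e\<close> itself.\<close>
  have piece_D: "piece (b e) (anchor e) = D e" if e: "e \<in> C" for e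
  proof -
    define e' where "e' = (SOME e'. e' \<in> C \<and> b e' = b e \<and> anchor e' = anchor e)"
    have "e' \<in> C \<and> b e' = b e \<and> anchor e' = anchor e" unfolding e'_def
      by (rule someI[of _ e]) (simp add: e)
    then have e': "e' \<in> C" "b e' = b e" "take (q e') (lab (v e')) = take (q e') (lab (v e))"
      using qP by (auto simp: anchor_def)
    have "u e' = u e \<and> v e' = v e"
      using compatible_edge[OF C[OF e'(1), THEN conjunct2] C[OF e, THEN conjunct2] comp[OF e'(1) e] e'(2,3)] .
    then have "e' = e" using C[OF e'(1)] C[OF e] by metis
    then show ?thesis using e by (auto simp: piece_def e'_def)
  qed
  define T where "T r = insert r (\<Union>z\<in>Z r. piece r z)" for r
  have finZ: "finite (Z r)" for r
    unfolding Z_def using fin finite_branches by (auto simp: tops_def)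
  have lenZ: "length z = Q" "prefix (lab r) z" if "z \<in> Z r" for r z
    using that tops(1,2) by (auto simp: Z_def)
  have grownT: "grown G r (T r)" for r
    unfolding T_def by (rule grown_union[OF finZ]) (use piece_ok lenZ in \<open>auto simp: ok_def\<close>)
  have TV: "T r \<subseteq> below (lab r)" if "r \<in> b ` C" for r
  proof -
    have "r \<in> below (lab r)" using that cb by (auto simp: below_def)
    moreover have "piece r z \<subseteq> below (lab r)" if "z \<in> Z r" for z
      using piece_ok[OF that] lenZ[OF that] by (auto simp: ok_def below_def intro: prefix_order.trans)
    ultimately show ?thesis by (auto simp: T_def)
  qed
  have finT: "finite (\<Union>z\<in>Z r. piece r z)" for r
    using grown_finite[OF grownT[of r]] by (simp add: T_def)
  have cardT: "k + 1 \<le> card (T (b e))" if e: "e \<in> C" for e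
  proof -
    \<comment> \<open>Either the tree of \<open>e\<close> alone has \<open>k\<close> vertices
      besides its top, or each of at least \<open>k\<close> subtrees contributes one.\<close>
    have "k \<le> card (\<Union>z\<in>Z (b e). piece (b e) z)"
    proof (cases "Q = P")
      case True
      have "k \<le> card (D e)" using C[OF e] qP[OF e] True by (simp add: cert_def)
      also have "\<dots> \<le> card (\<Union>z\<in>Z (b e). piece (b e) z)"
        using e anchor_tops[OF e] piece_D[OF e] by (intro card_mono finT) (auto simp: Z_def)
      finally show ?thesis .
    next
      case False
      have "k \<le> card (tops e)" using rich(2)[OF e False] False
        by (simp add: tops_def card_image inj_on_def)
      also have "\<dots> \<le> card (Z (b e))" by (rule card_mono[OF finZ]) (use e in \<open>auto simp: Z_def\<close>)
      also have "\<dots> \<le> card (\<Union>z\<in>Z (b e). piece (b e) z)"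
        by (rule card_union_ge[OF finT, where q = Q]) (use piece_ok lenZ in \<open>auto simp: ok_def\<close>)
      finally show ?thesis .
    qed
    moreover have "b e \<notin> (\<Union>z\<in>Z (b e). piece (b e) z)" using piece_ok by (auto simp: ok_def)
    ultimately show ?thesis using finT by (simp add: T_def)
  qed
  have "strong_forest k G (induced_subgraph G (\<Union>r\<in>b ` C. T r))"
  proof (rule strong_forest_union[OF simple])
    show "grown G r (T r) \<and> T r \<subseteq> verts G \<and> k + 1 \<le> card (T r)" if "r \<in> b ` C" for r
      using grownT TV[OF that] cardT that by (auto simp: below_def)
    show "x \<noteq> y \<and> \<not> adj G x y"
      if "r \<in> b ` C" "r' \<in> b ` C" "r \<noteq> r'" "x \<in> T r" "y \<in> T r'" for r r' x y
    proof (rule below_separated)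
      have r: "r \<in> verts G" "r' \<in> verts G" "length (lab r) = P" "length (lab r') = P"
        using that cb(1) qP(2) by auto
      then show "length (lab r) = length (lab r')" "lab r \<noteq> lab r'"
        using that(3) inj by (auto dest: inj_onD)
    qed (use TV that in auto)
  qed
  moreover have "C \<subseteq> edges (induced_subgraph G (\<Union>r\<in>b ` C. T r))"
  proof
    fix e assume e: "e \<in> C"
    have ee: "e = {u e, v e}" using C[OF e] by (rule conjunct1)
    have "{u e, v e} \<subseteq> insert (b e) (D e)" using C[OF e, THEN conjunct2] by (simp add: cert_def)
    then have "e \<subseteq> insert (b e) (D e)" by (rule ord_eq_le_trans[OF ee])
    also have "\<dots> \<subseteq> T (b e)"
      using piece_D[OF e] anchor_tops[OF e] e by (auto simp: T_def Z_def)
    finally have "e \<subseteq> (\<Union>r\<in>b ` C. T r)" using e by blast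
    moreover have "{u e, v e} \<in> edges G" using C[OF e, THEN conjunct2] by (simp add: cert_def adj_def)
    then have "e \<in> edges G" by (rule ssubst[OF ee, of "\<lambda>x. x \<in> edges G"])
    ultimately show "e \<in> edges (induced_subgraph G (\<Union>r\<in>b ` C. T r))"
      by (simp add: induced_subgraph_def)
  qed
  ultimately show ?thesis by blast
qed

end

section \<open>Counting\<close>

text \<open>An upper bound and an arbitrary set of edges, so that covers of parts can be
  combined.\<close>

definition coverable :: "'a sgraph \<Rightarrow> nat \<Rightarrow> 'a set set \<Rightarrow> nat \<Rightarrow> bool" where
  "coverable G k E N \<longleftrightarrow>
     (\<exists>\<F>. finite \<F> \<and> card \<F> \<le> N \<and> (\<forall>F\<in>\<F>. strong_forest k G F) \<and> E \<subseteq> (\<Union>F\<in>\<F>. edges F))"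

lemma coverable_arboricity:
  assumes "coverable G k {e. valid_edge k G e} N"
  shows "strong_induced_arboricity k G \<le> N"
proof -
  obtain \<F> where F: "finite \<F>" "card \<F> \<le> N" "\<forall>F\<in>\<F>. strong_forest k G F"
    "{e. valid_edge k G e} \<subseteq> (\<Union>F\<in>\<F>. edges F)"
    using assms by (auto simp: coverable_def)
  then have "strong_induced_arboricity k G \<le> card \<F>"
    unfolding strong_induced_arboricity_def by (intro Least_le exI[of _ \<F>]) auto
  then show ?thesis using F(2) by simp
qed

lemma coverable_mono: "coverable G k E N \<Longrightarrow> E' \<subseteq> E \<Longrightarrow> N \<le> N' \<Longrightarrow> coverable G k E' N'"
  unfolding coverable_def by (meson order_trans)

lemma coverable_UN:
  assumes "finite I" "\<And>i. i \<in> I \<Longrightarrow> coverable G k (E i) N"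
  shows "coverable G k (\<Union>i\<in>I. E i) (N * card I)"
  using assms
proof (induction I rule: finite_induct)
  case empty
  then show ?case by (auto simp: coverable_def)
next
  case (insert i I)
  obtain \<F> where F: "finite \<F>" "card \<F> \<le> N" "\<forall>F\<in>\<F>. strong_forest k G F" "E i \<subseteq> (\<Union>F\<in>\<F>. edges F)"
    using insert.prems[of i] by (auto simp: coverable_def)
  obtain \<G> where G: "finite \<G>" "card \<G> \<le> N * card I" "\<forall>F\<in>\<G>. strong_forest k G F"
    "(\<Union>i\<in>I. E i) \<subseteq> (\<Union>F\<in>\<G>. edges F)"
    using insert.IH insert.prems by (auto simp: coverable_def)
  have "card (\<F> \<union> \<G>) \<le> N * card (insert i I)"
    using card_Un_le[of \<F> \<G>] F G insert.hyps by simp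
  then show ?case using F G unfolding coverable_def by (intro exI[of _ "\<F> \<union> \<G>"]) auto
qed

text \<open>Inducing twice is inducing once, and strength depends on the components of the forest
  alone.\<close>

lemma coverable_induced:
  assumes "S \<subseteq> verts G" "coverable (induced_subgraph G S) k E N"
  shows "coverable G k E N"
proof -
  have vS: "verts (induced_subgraph G S) = S" by (simp add: induced_subgraph_def)
  have "strong_forest k G F" if F: "strong_forest k (induced_subgraph G S) F" for F
  proof -
    obtain S' where S': "S' \<subseteq> S" "F = induced_subgraph (induced_subgraph G S) S'" "acyclic_graph F"
      using F unfolding strong_forest_def induced_forest_def vS by blast
    have "induced_subgraph (induced_subgraph G S) S' = induced_subgraph G S'"
      using S'(1) by (auto simp: induced_subgraph_def)
    then show ?thesis using F S' assms(1) unfolding strong_forest_def induced_forest_def by auto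
  qed
  then show ?thesis using assms(2) unfolding coverable_def by blast
qed

lemma core_induced:
  assumes "core G k e X" "X \<subseteq> S"
  shows "core (induced_subgraph G S) k e X"
proof -
  have a: "adj (induced_subgraph G S) x y \<longleftrightarrow> adj G x y" if "x \<in> X" "y \<in> X" for x y
    using that assms(2) by (auto simp: adj_def induced_subgraph_def)
  have s: "steps (induced_subgraph G S) X = steps G X" using a by (auto simp: steps_def)
  have p: "path_in (induced_subgraph G S) X p \<longleftrightarrow> path_in G X p" for p
    unfolding path_in_def using successively_cong[of p "adj (induced_subgraph G S)" "adj G"] a by blast
  have "acyclic_in (induced_subgraph G S) X"
    unfolding acyclic_in_def p
  proof safe
    fix q assume q: "path_in G X q" "3 \<le> length q" "adj (induced_subgraph G S) (last q) (hd q)"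
    then have "last q \<in> X" "hd q \<in> X" by (auto simp: path_in_def)
    then show False using q a assms(1) by (auto simp: core_def acyclic_in_def)
  qed
  then show ?thesis using assms unfolding core_def connected_in_def s
    by (auto simp: induced_subgraph_def)
qed

lemma simple_graph_induced:
  assumes G: "simple_graph G" and S: "S \<subseteq> verts G"
  shows "simple_graph (induced_subgraph G S)"
proof -
  have "finite S" using G S by (auto simp: simple_graph_def intro: finite_subset)
  moreover have "\<exists>u v. e = {u, v} \<and> u \<in> S \<and> v \<in> S \<and> u \<noteq> v" if e: "e \<in> edges G" "e \<subseteq> S" for e
    using edge_endpoints[OF G e(1)] e(2) by auto
  ultimately show ?thesis by (simp add: simple_graph_def induced_subgraph_def subset_iff)
qed

lemma grown_star:
  assumes "finite Y" "r \<notin> Y" "\<And>y. y \<in> Y \<Longrightarrow> adj G r y" "\<And>x y. x \<in> Y \<Longrightarrow> y \<in> Y \<Longrightarrow> \<not> adj G x y"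
  shows "grown G r (insert r Y)"
  using assms
proof (induction Y rule: finite_induct)
  case empty
  then show ?case by (simp add: grown.root)
next
  case (insert y Y)
  have yr: "adj G y r" using insert.prems(2)[of y] by (simp add: adj_commute)
  have only: "z = r" if "z \<in> insert r Y" "adj G y z" for z
    using insert.prems(3)[of y z] that by auto
  have "grown G r (insert r Y)" "y \<notin> insert r Y"
    using insert.IH insert.prems insert.hyps by auto
  then have "grown G r (insert y (insert r Y))" by (rule grown.grow[OF _ _ insertI1 yr only])
  then show ?case by (simp add: insert_commute)
qed

context labelled_graph
begin

lemma finite_edges: "finite (edges G)"
proof (rule finite_subset)
  show "edges G \<subseteq> Pow (verts G)" using simple by (auto simp: simple_graph_def)
qed (simp add: finite_verts)

lemma coverable_cores:
  assumes k: "k \<ge> 1"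
  shows "coverable G k {e. \<exists>X. core G k e X} ((2 * k) ^ d)"
proof -
  define E where "E = {e. \<exists>X. core G k e X}"
  have finE: "finite E" by (rule finite_subset[OF _ finite_edges]) (auto simp: E_def core_def)
  \<comment> \<open>The six data of a certificate are packed into one tuple so that a single choice
    fixes them together.\<close>
  have "\<forall>e\<in>E. \<exists>t. e = {fst t, fst (snd t)} \<and> cert k (fst t) (fst (snd t)) (fst (snd (snd t)))
    (fst (snd (snd (snd t)))) (fst (snd (snd (snd (snd t))))) (snd (snd (snd (snd (snd t)))))"
  proof
    fix e assume "e \<in> E"
    then obtain X where "core G k e X" unfolding E_def by blast
    from cert_exists[OF this] obtain u v b q D J where "e = {u, v}" "cert k u v b q D J" by blast
    then show "\<exists>t. e = {fst t, fst (snd t)} \<and> cert k (fst t) (fst (snd t)) (fst (snd (snd t)))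
      (fst (snd (snd (snd t)))) (fst (snd (snd (snd (snd t))))) (snd (snd (snd (snd (snd t)))))"
      by (intro exI[of _ "(u, v, b, q, D, J)"]) simp
  qed
  then obtain t where t: "\<forall>e\<in>E. e = {fst (t e), fst (snd (t e))} \<and> cert k (fst (t e)) (fst (snd (t e))) (fst (snd (snd (t e))))
    (fst (snd (snd (snd (t e))))) (fst (snd (snd (snd (snd (t e)))))) (snd (snd (snd (snd (snd (t e))))))"
    by (rule bchoice[THEN exE])
  define u where "u e = fst (t e)" for e
  define v where "v e = fst (snd (t e))" for e
  define b where "b e = fst (snd (snd (t e)))" for e
  define q where "q e = fst (snd (snd (snd (t e))))" for e
  define D where "D e = fst (snd (snd (snd (snd (t e)))))" for e
  define J where "J e = snd (snd (snd (snd (snd (t e)))))" for e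
  have c: "e = {u e, v e} \<and> cert k (u e) (v e) (b e) (q e) (D e) (J e)" if "e \<in> E" for e
    using t that unfolding u_def v_def b_def q_def D_def J_def by blast
  \<comment> \<open>The fibres of \<open>sg\<close> are the classes. Restriction to the levels from
    \<open>1\<close> to \<open>d\<close> puts its values into a function space with
    \<open>(2 * k) ^ d\<close> elements.\<close>
  define sg where "sg e = restrict (\<lambda>l. (l \<in> J e, num k (v e) (b e) (q e) (J e) l)) {1..d}" for e
  have sub: "sg ` E \<subseteq> {1..d} \<rightarrow>\<^sub>E UNIV \<times> {..<k}"
    using num_less[OF c[THEN conjunct2] k] by (auto simp: sg_def)
  have "card (sg ` E) \<le> card ({1..d} \<rightarrow>\<^sub>E (UNIV :: bool set) \<times> {..<k})"
    by (rule card_mono[OF finite_PiE sub]) auto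
  also have "\<dots> = (2 * k) ^ d" by (simp add: card_PiE card_cartesian_product)
  finally have card: "card (sg ` E) \<le> (2 * k) ^ d" .
  have "coverable G k {e\<in>E. sg e = s} 1" for s
  proof -
    have "\<exists>F. strong_forest k G F \<and> {e\<in>E. sg e = s} \<subseteq> edges F"
    proof (rule class_forest[where u = u and v = v and b = b and q = q and D = D and J = J])
      show "compatible k (v e) (b e) (q e) (J e) (v e') (b e') (q e') (J e')"
        if "e \<in> {e\<in>E. sg e = s}" "e' \<in> {e\<in>E. sg e = s}" for e e'
      proof -
        have sg: "sg e = sg e'" using that by simp
        show ?thesis unfolding compatible_def
        proof
          fix l assume "l \<in> {1..d}"
          then show "(l \<in> J e \<longleftrightarrow> l \<in> J e') \<and>
              num k (v e) (b e) (q e) (J e) l = num k (v e') (b e') (q e') (J e') l"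
            using fun_cong[OF sg, of l] by (simp add: sg_def)
        qed
      qed
    qed (use c finE in \<open>blast, simp\<close>)
    then obtain F where "strong_forest k G F" "{e\<in>E. sg e = s} \<subseteq> edges F" by blast
    then show ?thesis unfolding coverable_def by (intro exI[of _ "{F}"]) auto
  qed
  then have "coverable G k (\<Union>s\<in>sg ` E. {e\<in>E. sg e = s}) (1 * card (sg ` E))"
    using finE by (intro coverable_UN) auto
  then show ?thesis unfolding E_def[symmetric] by (rule coverable_mono) (use card in auto)
qed

text \<open>The entries of the new labels are whole prefixes of the old ones, at the lengths in
  \<open>L\<close>. This bounds their number by \<open>card L\<close>, while the last entry, the old
  label itself, keeps the labels distinct.\<close>

lemma labelled_graph_levels:
  assumes "finite L"
  shows "labelled_graph (induced_subgraph G {v \<in> verts G. length (lab v) \<in> L})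
    (\<lambda>v. map (\<lambda>i. take i (lab v)) (filter (\<lambda>i. i \<in> L) [1..<Suc (length (lab v))])) (card L)"
    (is "labelled_graph ?H ?f _")
proof
  let ?S = "{v \<in> verts G. length (lab v) \<in> L}"
  show "simple_graph ?H" by (rule simple_graph_induced[OF simple]) auto
  have vH: "verts ?H = ?S" by (simp add: induced_subgraph_def)
  have f: "?f v = map (\<lambda>i. take i (lab v)) (filter (\<lambda>i. i \<in> L) [1..<length (lab v)]) @ [lab v]"
    if "v \<in> ?S" for v
    using that nonempty[of v] by (simp add: Suc_le_eq)
  show "inj_on ?f (verts ?H)"
  proof (rule inj_onI)
    fix x y assume "x \<in> verts ?H" "y \<in> verts ?H" "?f x = ?f y"
    then show "x = y" using f[of x] f[of y] inj unfolding vH by (auto dest: inj_onD)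
  qed
  show "?f v \<noteq> []" if "v \<in> verts ?H" for v
    using f[of v] that unfolding vH by simp
  show "length (?f v) \<le> card L" if "v \<in> verts ?H" for v
  proof -
    have "length (?f v) = card (set (filter (\<lambda>i. i \<in> L) [1..<Suc (length (lab v))]))"
      by (simp only: length_map distinct_card distinct_filter distinct_upt)
    also have "\<dots> \<le> card L" by (rule card_mono[OF assms]) auto
    finally show ?thesis .
  qed
  have mono: "prefix (?f x) (?f y)" if xy: "prefix (lab x) (lab y)" for x y
  proof -
    obtain w where w: "lab y = lab x @ w" using xy by (auto simp: prefix_def)
    have "[1..<Suc (length (lab y))] = [1..<Suc (length (lab x))] @ [Suc (length (lab x))..<Suc (length (lab y))]"
      using upt_add_eq_append[of 1 "Suc (length (lab x))" "length w"] by (simp add: w)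
    then have "prefix (map (\<lambda>i. take i (lab y)) (filter (\<lambda>i. i \<in> L) [1..<Suc (length (lab x))])) (?f y)"
      by (simp only: filter_append map_append prefixI)
    moreover have "map (\<lambda>i. take i (lab y)) (filter (\<lambda>i. i \<in> L) [1..<Suc (length (lab x))]) = ?f x"
      by (rule map_cong) (auto simp: w)
    ultimately show ?thesis by (simp only:)
  qed
  show "prefix (?f x) (?f y) \<or> prefix (?f y) (?f x)" if "adj ?H x y" for x y
  proof -
    have "adj G x y" using that by (simp add: adj_def induced_subgraph_def)
    then show ?thesis using comparable mono by blast
  qed
qed

lemma coverable_valid:
  assumes "k \<ge> 1"
  shows "coverable G k {e. valid_edge k G e} ((2 * k) ^ d)"
  by (rule coverable_mono[OF coverable_cores[OF assms]]) (use valid_edge_core[OF simple assms] in auto)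

text \<open>A tree with \<open>k + 1\<close> vertices survives in the subgraph induced by some
  \<open>k + 1\<close> levels, whose labelling has depth \<open>k + 1\<close>. One cover is used for
  each such set of levels.\<close>

lemma coverable_valid_levels:
  assumes k: "k \<ge> 1" and d: "d \<ge> k + 1"
  shows "coverable G k {e. valid_edge k G e} ((2 * k) ^ (k + 1) * (d choose (k + 1)))"
proof -
  define I where "I = {L. L \<subseteq> {1..d} \<and> card L = k + 1}"
  define S where "S L = {v \<in> verts G. length (lab v) \<in> L}" for L
  define E where "E L = {e. \<exists>X. core (induced_subgraph G (S L)) k e X}" for L
  have cardI: "card I = d choose (k + 1)" using n_subsets[of "{1..d}" "k + 1"] by (simp add: I_def)
  have "coverable G k (E L) ((2 * k) ^ (k + 1))" if "L \<in> I" for L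
  proof -
    have L: "finite L" "card L = k + 1" using that finite_subset[of L "{1..d}"] by (auto simp: I_def)
    have "S L \<subseteq> verts G" by (auto simp: S_def)
    moreover have "coverable (induced_subgraph G (S L)) k (E L) ((2 * k) ^ (k + 1))"
      using labelled_graph.coverable_cores[OF labelled_graph_levels[OF L(1)] k]
      unfolding L(2) E_def S_def .
    ultimately show ?thesis by (rule coverable_induced)
  qed
  moreover have "finite I" unfolding I_def by (rule finite_subset[of _ "Pow {1..d}"]) auto
  ultimately have "coverable G k (\<Union>L\<in>I. E L) ((2 * k) ^ (k + 1) * card I)"
    by (intro coverable_UN)
  moreover have "{e. valid_edge k G e} \<subseteq> (\<Union>L\<in>I. E L)"
  proof
    fix e assume "e \<in> {e. valid_edge k G e}"
    then obtain X where X: "core G k e X" "card X = k + 1" using valid_edge_core[OF simple k] by blast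
    have XV: "X \<subseteq> verts G" using X by (simp add: core_def)
    let ?l = "\<lambda>v. length (lab v)"
    have "finite X" using X(2) by (simp add: card_ge_0_finite)
    then have "card (?l ` X) \<le> k + 1" using card_image_le[of X ?l] X(2) by simp
    moreover have "?l ` X \<subseteq> {1..d}" using XV nonempty length_le by (fastforce simp: Suc_le_eq)
    \<comment> \<open>The tree may meet fewer levels; \<open>d \<ge> k + 1\<close> leaves room to
      enlarge them to exactly \<open>k + 1\<close>.\<close>
    ultimately obtain L where L: "?l ` X \<subseteq> L" "L \<subseteq> {1..d}" "card L = k + 1"
      using exists_subset_between[of "?l ` X" "k + 1" "{1..d}"] d by auto
    then have "X \<subseteq> S L" using XV by (auto simp: S_def)
    then have "e \<in> E L" using core_induced[OF X(1)] by (auto simp: E_def)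
    then show "e \<in> (\<Union>L\<in>I. E L)" using L by (auto simp: I_def)
  qed
  ultimately show ?thesis unfolding cardI by (rule coverable_mono) simp
qed

text \<open>A vertex has at most one ancestor at level \<open>i\<close>, so the edges form stars
  centred there. Leaves share a level and are not adjacent, and different stars lie in separated
  subtrees.\<close>

lemma coverable_edges_two_levels:
  assumes ij: "i < j"
  shows "coverable G 1 {{x, y} | x y. adj G x y \<and> length (lab x) = i \<and> length (lab y) = j} 1"
proof -
  define N where "N a = {y. adj G a y \<and> length (lab y) = j}" for a
  define R where "R = {a. length (lab a) = i \<and> N a \<noteq> {}}"
  define T where "T a = insert a (N a)" for a
  have finN: "finite (N a)" for a
    by (rule finite_subset[OF _ finite_verts]) (use adj_verts in \<open>auto simp: N_def\<close>)
  have R: "r \<in> verts G" "length (lab r) = i" "N r \<noteq> {}" if "r \<in> R" for r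
    using that adj_verts by (auto simp: R_def N_def)
  have TV: "T r \<subseteq> below (lab r)" if r: "r \<in> R" for r
  proof -
    have "prefix (lab r) (lab y)" "y \<in> verts G" if "y \<in> N r" for y
      using that R(2)[OF r] ij adj_length_prefix[of r y] adj_verts(2)[of r y] by (auto simp: N_def)
    then show ?thesis using R(1)[OF r] by (auto simp: T_def below_def)
  qed
  have "strong_forest 1 G (induced_subgraph G (\<Union>r\<in>R. T r))"
  proof (rule strong_forest_union[OF simple])
    fix r assume r: "r \<in> R"
    have rN: "r \<notin> N r" using adj_verts(3) by (auto simp: N_def)
    have "grown G r (T r)" unfolding T_def
      by (rule grown_star[OF finN rN]) (auto simp: N_def dest: adj_levels)
    moreover have "card (T r) \<ge> 2" using R(3)[OF r] rN finN[of r] by (simp add: T_def card_gt_0_iff Suc_le_eq)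
    ultimately show "grown G r (T r) \<and> T r \<subseteq> verts G \<and> 1 + 1 \<le> card (T r)"
      using TV[OF r] by (auto simp: below_def)
  next
    show "x \<noteq> y \<and> \<not> adj G x y"
      if "r \<in> R" "r' \<in> R" "r \<noteq> r'" "x \<in> T r" "y \<in> T r'" for r r' x y
    proof (rule below_separated)
      show "length (lab r) = length (lab r')" "lab r \<noteq> lab r'"
        using R[OF that(1)] R[OF that(2)] that(3) inj by (auto dest: inj_onD)
    qed (use TV that in auto)
  qed
  moreover have "{{x, y} | x y. adj G x y \<and> length (lab x) = i \<and> length (lab y) = j}
      \<subseteq> edges (induced_subgraph G (\<Union>r\<in>R. T r))"
  proof safe
    fix x y assume xy: "adj G x y" "i = length (lab x)" "j = length (lab y)"
    then have "x \<in> R" "{x, y} \<subseteq> T x" by (auto simp: R_def N_def T_def)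
    then show "{x, y} \<in> edges (induced_subgraph G (\<Union>r\<in>R. T r))"
      using xy(1) by (auto simp: induced_subgraph_def adj_def)
  qed
  ultimately show ?thesis unfolding coverable_def
    by (intro exI[of _ "{induced_subgraph G (\<Union>r\<in>R. T r)}"]) auto
qed

lemma coverable_valid_one: "coverable G 1 {e. valid_edge 1 G e} (d choose 2)"
proof -
  define I where "I = {L. L \<subseteq> {1..d} \<and> card L = 2}"
  define E where "E L = {{x, y} | x y. adj G x y \<and> length (lab x) = Min L \<and> length (lab y) = Max L}" for L
  have cardI: "card I = d choose 2" using n_subsets[of "{1..d}" 2] by (simp add: I_def)
  have "coverable G 1 (E L) 1" if "L \<in> I" for L
  proof -
    have "card L = 2" using that by (simp add: I_def)
    then obtain i j where "L = {i, j}" "i \<noteq> j" unfolding card_2_iff by blast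
    then have "Min L < Max L" by auto
    then show ?thesis unfolding E_def by (rule coverable_edges_two_levels)
  qed
  moreover have "finite I" unfolding I_def by (rule finite_subset[of _ "Pow {1..d}"]) auto
  ultimately have "coverable G 1 (\<Union>L\<in>I. E L) (1 * card I)" by (intro coverable_UN)
  moreover have "{e. valid_edge 1 G e} \<subseteq> (\<Union>L\<in>I. E L)"
  proof
    fix e assume "e \<in> {e. valid_edge 1 G e}"
    then have "e \<in> edges G" by (simp add: valid_edge_def)
    then obtain x y where xy: "e = {x, y}" "adj G x y" "length (lab x) < length (lab y)"
      using oriented_edge by blast
    define L where "L = {length (lab x), length (lab y)}"
    have "L \<in> I" using xy adj_verts[OF xy(2)] nonempty length_le
      by (auto simp: I_def L_def Suc_le_eq)
    moreover have "Min L = length (lab x)" "Max L = length (lab y)" using xy(3) by (auto simp: L_def)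
    then have "e \<in> E L" using xy by (auto simp: E_def)
    ultimately show "e \<in> (\<Union>L\<in>I. E L)" by blast
  qed
  ultimately show ?thesis unfolding cardI by (rule coverable_mono) simp
qed

end

section \<open>From tree-depth to labellings\<close>

lemma is_path_path_in: "is_path G p \<longleftrightarrow> path_in G (verts G) p"
  unfolding is_path_def path_in_def adj_def ..

lemma acyclic_graph_in: "acyclic_graph G \<longleftrightarrow> acyclic_in G (verts G)"
  unfolding acyclic_graph_def acyclic_in_def is_cycle_def is_path_path_in adj_def by simp

lemma joined_steps: "joined G u v \<longleftrightarrow> u \<in> verts G \<and> (u, v) \<in> (steps G (verts G))\<^sup>*"
  by (simp add: joined_def is_path_path_in ex_path_in)

text \<open>A path to the root cannot pass through the new leaf \<open>x\<close>, whose only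
  neighbour in \<open>A\<close> is \<open>y\<close>; it can only start there.\<close>

lemma path_to_root_cases:
  assumes "path_in G (insert x A) p" "last p = r" "r \<noteq> x"
    and only: "\<And>z. z \<in> A \<Longrightarrow> adj G x z \<Longrightarrow> z = y"
  shows "path_in G A p \<and> hd p \<noteq> x \<or> (\<exists>p'. p = x # p' \<and> path_in G A p' \<and> hd p' = y \<and> last p' = r)"
proof (cases "x \<in> set p")
  case False
  then have "path_in G A p" using assms(1) by (auto simp: path_in_def)
  moreover have "hd p \<noteq> x" using False assms(1) by (cases p) (auto simp: path_in_def)
  ultimately show ?thesis by blast
next
  case True
  then obtain a b where p: "p = a @ x # b" by (meson split_list)
  have d: "distinct p" "set p \<subseteq> insert x A" and s: "successively (adj G) p"
    using assms(1) by (auto simp: path_in_def)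
  have b: "b \<noteq> []" using assms(2,3) p by auto
  have "adj G x (hd b)" using s b p by (auto simp: successively_append_iff successively_Cons)
  moreover have "hd b \<in> A" using d p hd_in_set[OF b] by auto
  ultimately have hb: "hd b = y" using only by blast
  have "a = []"
  proof (rule ccontr)
    assume a: "a \<noteq> []"
    have "adj G (last a) x" using s a p by (auto simp: successively_append_iff)
    moreover have "last a \<in> A" using d p last_in_set[OF a] by auto
    ultimately have "last a = y" using only[of "last a"] adj_commute[of G x "last a"] by blast
    then show False using d p hb last_in_set[OF a] hd_in_set[OF b] by auto
  qed
  then have "p = x # b" "path_in G A b" "last b = r"
    using p d s b assms(2) by (auto simp: path_in_def successively_Cons)
  then show ?thesis using hb by blast
qed

lemma grown_path_unique:
  "grown G r A \<Longrightarrow> path_in G A p \<Longrightarrow> path_in G A q \<Longrightarrow> hd p = hd q \<Longrightarrow> last p = r \<Longrightarrow> last q = r \<Longrightarrow> p = q"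
proof (induction arbitrary: p q rule: grown.induct)
  case root
  have "l = [r]" if "path_in G {r} l" for l
    using that by (cases l; cases "tl l") (auto simp: path_in_def)
  then show ?case using root by metis
next
  case (grow A x y)
  have xr: "r \<noteq> x" using grown_root[OF grow.hyps(1)] grow.hyps(2) by blast
  note p = path_to_root_cases[OF grow.prems(1) grow.prems(4) xr grow.hyps(5)]
  note q = path_to_root_cases[OF grow.prems(2) grow.prems(5) xr grow.hyps(5)]
  show ?case
  proof (cases "hd p = x")
    case True
    then obtain p' where p': "p = x # p'" "path_in G A p'" "hd p' = y" "last p' = r" using p by auto
    obtain q' where q': "q = x # q'" "path_in G A q'" "hd q' = y" "last q' = r"
      using q True grow.prems(3) by auto
    show ?thesis using grow.IH[OF p'(2) q'(2)] p' q' by simp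
  next
    case False
    then have "path_in G A p" "path_in G A q" using p q grow.prems(3) by auto
    then show ?thesis using grow.IH grow.prems by blast
  qed
qed

text \<open>The label of a vertex is its path to the root, reversed. If \<open>v\<close> lies on the
  path of \<open>u\<close>, the rest of that path from \<open>v\<close> on is the path of
  \<open>v\<close>; reversal turns this into a prefix.\<close>

lemma rooted_tree_labels:
  fixes T :: "'a sgraph"
  assumes tree: "rooted_tree T r"
  shows "\<exists>f :: 'a \<Rightarrow> 'a list. inj_on f (verts T) \<and> (\<forall>x\<in>verts T. f x \<noteq> [] \<and> length (f x) \<le> rooted_depth T r) \<and>
    (\<forall>x y. {x, y} \<in> edges (transitive_closure T r) \<longrightarrow> prefix (f x) (f y) \<or> prefix (f y) (f x))"
proof -
  let ?V = "verts T"
  have T: "simple_graph T" "acyclic_in T ?V" "r \<in> ?V"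
    using tree by (auto simp: rooted_tree_def acyclic_graph_in)
  have con: "connected_in T ?V"
    using tree by (auto simp: rooted_tree_def connected_graph_def connected_in_def joined_steps)
  have fin: "finite ?V" using T by (simp add: simple_graph_def)
  have grown: "grown T r ?V" by (rule grownI[OF con T(2) fin T(3)])
  define P where "P x p \<longleftrightarrow> path_in T ?V p \<and> hd p = x \<and> last p = r" for x p
  define f where "f x = rev (SOME p. P x p)" for x
  have uniq: "p = q" if "P x p" "P x q" for x p q
    using grown_path_unique[OF grown] that by (auto simp: P_def)
  have P: "P x (rev (f x))" if "x \<in> ?V" for x
  proof -
    have "(x, r) \<in> (steps T ?V)\<^sup>*" using con that T(3) by (simp add: connected_in_def)
    then have "\<exists>p. P x p" using steps_path_in[OF _ that] by (simp add: P_def)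
    then show ?thesis unfolding f_def rev_rev_ident by (rule someI_ex)
  qed
  have on_path: "prefix (f v) (f u)" if p: "P u p" and v: "v \<in> set p" for u v p
  proof -
    obtain a b where ab: "p = a @ v # b" using v by (meson split_list)
    have V: "u \<in> ?V" "v \<in> ?V" using p v by (auto simp: P_def path_in_def)
    have "P v (v # b)" using p by (auto simp: P_def path_in_def ab successively_append_iff)
    then have "rev (f v) = v # b" "rev (f u) = p" using uniq P V p by blast+
    then have "f u = f v @ rev a" by (simp add: ab rev_swap)
    then show ?thesis by simp
  qed
  have "inj_on f ?V"
  proof (rule inj_onI)
    fix x y assume "x \<in> ?V" "y \<in> ?V" "f x = f y"
    then show "x = y" using P[of x] P[of y] by (simp add: P_def)
  qed
  moreover have "f x \<noteq> [] \<and> length (f x) \<le> rooted_depth T r" if x: "x \<in> ?V" for x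
  proof -
    have bound: "length p \<le> card ?V" if "is_path T p" for p
      using that card_mono[OF fin, of "set p"] by (simp add: is_path_def distinct_card)
    have "{length p | p. is_path T p \<and> last p = r} \<subseteq> {..card ?V}" using bound by blast
    then have "finite {length p | p. is_path T p \<and> last p = r}" by (rule finite_subset) simp
    moreover have "length (f x) \<in> {length p | p. is_path T p \<and> last p = r}"
      using P[OF x] by (auto simp: P_def is_path_path_in intro!: exI[of _ "rev (f x)"])
    ultimately show ?thesis using P[OF x] by (auto simp: rooted_depth_def P_def path_in_def)
  qed
  moreover have "prefix (f x) (f y) \<or> prefix (f y) (f x)"
    if xy: "{x, y} \<in> edges (transitive_closure T r)" for x y
  proof -
    have "adj T x y \<or> (\<exists>u v p. {x, y} = {u, v} \<and> P u p \<and> v \<in> set p)"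
      using xy unfolding transitive_closure_def P_def is_path_path_in[symmetric] adj_def by auto
    then show ?thesis
    proof
      assume a: "adj T x y"
      then have V: "x \<in> ?V" "y \<in> ?V" using adj_vertsD[OF T(1) a] by auto
      show ?thesis
      proof (cases "y \<in> set (rev (f x))")
        case True
        then show ?thesis using on_path[OF P[OF V(1)]] by blast
      next
        case False
        \<comment> \<open>The path of \<open>x\<close> prolonged by \<open>y\<close> is the path of
          \<open>y\<close>, which therefore contains \<open>x\<close>.\<close>
        have "P y (y # rev (f x))"
          using False P[OF V(1)] V a unfolding P_def path_in_def
          by (auto simp: successively_Cons adj_commute)
        moreover have "x \<in> set (y # rev (f x))" 
          using P[OF V(1)] hd_in_set[of "rev (f x)"] by (auto simp: P_def path_in_def)
        ultimately show ?thesis using on_path by blast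
      qed
    next
      assume "\<exists>u v p. {x, y} = {u, v} \<and> P u p \<and> v \<in> set p"
      then obtain u v p where uv: "{x, y} = {u, v}" "P u p" "v \<in> set p" by blast
      have "x = u \<and> y = v \<or> x = v \<and> y = u" using uv(1) by (auto simp: doubleton_eq_iff)
      then show ?thesis using on_path[OF uv(2,3)] by auto
    qed
  qed
  ultimately have "inj_on f ?V \<and> (\<forall>x\<in>?V. f x \<noteq> [] \<and> length (f x) \<le> rooted_depth T r) \<and>
      (\<forall>x y. {x, y} \<in> edges (transitive_closure T r) \<longrightarrow> prefix (f x) (f y) \<or> prefix (f y) (f x))"
    by simp
  then show ?thesis by (rule exI[of _ f])
qed

section \<open>The minimum in the definition of tree-depth is attained\<close>

definition line_graph :: "nat \<Rightarrow> nat sgraph" where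
  "line_graph n = Graph {..<n} {{i, Suc i} | i. Suc i < n}"

lemma line_graph_path:
  "u < n \<Longrightarrow> is_path (line_graph n) (rev [0..<Suc u]) \<and> hd (rev [0..<Suc u]) = u \<and> last (rev [0..<Suc u]) = 0"
proof (induction u)
  case 0
  then show ?case by (simp add: is_path_def line_graph_def)
next
  case (Suc u)
  then have IH: "is_path (line_graph n) (rev [0..<Suc u])" "hd (rev [0..<Suc u]) = u"
    "last (rev [0..<Suc u]) = 0" by auto
  have "{Suc u, u} \<in> edges (line_graph n)" using Suc.prems by (auto simp: line_graph_def)
  moreover have "rev [0..<Suc (Suc u)] = Suc u # rev [0..<Suc u]" by simp
  ultimately show ?case using IH Suc.prems by (auto simp: is_path_def line_graph_def successively_Cons)
qed

lemma line_graph_adj: "adj (line_graph n) i j \<longleftrightarrow> (j = Suc i \<and> j < n \<or> i = Suc j \<and> i < n)"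
  by (auto simp: adj_def line_graph_def doubleton_eq_iff)

lemma line_graph_grown: "m < n \<Longrightarrow> grown (line_graph n) 0 {..m}"
proof (induction m)
  case 0
  then show ?case by (simp add: grown.root atMost_0)
next
  case (Suc m)
  have "grown (line_graph n) 0 (insert (Suc m) {..m})"
    by (rule grown.grow[where y = m]) (use Suc in \<open>auto simp: line_graph_adj\<close>)
  then show ?case by (simp add: atMost_Suc)
qed

lemma line_graph_tree:
  assumes "n \<ge> 1"
  shows "rooted_tree (line_graph n) 0"
proof -
  have v: "verts (line_graph n) = {..n - 1}" using assms by (auto simp: line_graph_def)
  have g: "grown (line_graph n) 0 (verts (line_graph n))"
    unfolding v by (rule line_graph_grown) (use assms in simp)
  have "{i, Suc i} \<in> {{u, v} | u v. u < n \<and> v < n \<and> u \<noteq> v}" if "Suc i < n" for i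
    using that by force
  then have "simple_graph (line_graph n)" by (auto simp: simple_graph_def line_graph_def)
  moreover have "connected_graph (line_graph n)"
    using grown_connected[OF g] grown_root[OF g]
    by (auto simp: connected_graph_def joined_steps connected_in_def)
  ultimately show ?thesis
    using grown_acyclic[OF g] grown_root[OF g] by (simp add: rooted_tree_def acyclic_graph_in)
qed

lemma line_graph_depth:
  assumes "n \<ge> 1"
  shows "rooted_depth (line_graph n) 0 = n"
  unfolding rooted_depth_def
proof (rule Max_eqI)
  have "length p \<le> n" if "is_path (line_graph n) p" for p
    using that card_mono[of "{..<n}" "set p"] by (simp add: is_path_def distinct_card line_graph_def)
  then show le: "\<And>l. l \<in> {length p | p. is_path (line_graph n) p \<and> last p = 0} \<Longrightarrow> l \<le> n" by auto
  then have "{length p | p. is_path (line_graph n) p \<and> last p = 0} \<subseteq> {..n}" by blast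
  then show "finite {length p | p. is_path (line_graph n) p \<and> last p = 0}"
    by (rule finite_subset) simp
  show "n \<in> {length p | p. is_path (line_graph n) p \<and> last p = 0}"
    using line_graph_path[of "n - 1" n] assms by (auto intro!: exI[of _ "rev [0..<n]"])
qed

text \<open>The path from the larger vertex to the end \<open>0\<close> runs through the smaller
  one. The closure is thus complete, and every simple graph with at most \<open>n\<close> vertices
  embeds into it.\<close>

lemma line_graph_closure:
  assumes "u < n" "v < n" "u \<noteq> v"
  shows "{u, v} \<in> edges (transitive_closure (line_graph n) 0)"
proof -
  have "{a, b} \<in> edges (transitive_closure (line_graph n) 0)" if "a < n" "b < a" for a b
  proof -
    have "a \<noteq> b" "is_path (line_graph n) (rev [0..<Suc a]) \<and> hd (rev [0..<Suc a]) = a \<and>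
        last (rev [0..<Suc a]) = 0 \<and> b \<in> set (rev [0..<Suc a])"
      using line_graph_path[OF that(1)] that(2) by auto
    then show ?thesis unfolding transitive_closure_def by fastforce
  qed
  from this[of u v] this[of v u] show ?thesis using assms by (auto simp: insert_commute linorder_neq_iff)
qed

lemma components_induced:
  assumes "simple_graph G" "C \<in> components G"
  shows "verts C \<subseteq> verts G" "edges C \<subseteq> edges G"
proof -
  obtain u where u: "u \<in> verts G" "C = induced_subgraph G {v. joined G u v}"
    using assms by (auto simp: components_def)
  then show "verts C \<subseteq> verts G" "edges C \<subseteq> edges G"
    using steps_mem[of u _ G "verts G"] by (auto simp: induced_subgraph_def joined_steps)
qed

text \<open>\<open>LEAST\<close> has its intended meaning once one depth works for all components at
  once; \<open>card (verts G)\<close> does, by a path with that many vertices.\<close>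

lemma tree_depth_embeds:
  assumes G: "simple_graph G" and C: "C \<in> components G"
  shows "\<exists>(T :: nat sgraph) r. rooted_tree T r \<and> rooted_depth T r = tree_depth G \<and>
    embeds C (transitive_closure T r)"
proof -
  have "\<exists>d. \<forall>C\<in>components G. \<exists>(T :: nat sgraph) r.
     rooted_tree T r \<and> rooted_depth T r = d \<and> embeds C (transitive_closure T r)"
  proof (rule exI[of _ "card (verts G)"], rule ballI)
    fix C assume C: "C \<in> components G"
    define n where "n = card (verts G)"
    have fin: "finite (verts G)" using G by (simp add: simple_graph_def)
    have "verts G \<noteq> {}" using C by (auto simp: components_def)
    then have n: "n \<ge> 1" using fin by (simp add: n_def card_gt_0_iff Suc_le_eq)
    obtain h where h: "bij_betw h (verts G) {0..<n}"
      using ex_bij_betw_finite_nat[OF fin] by (auto simp: n_def)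
    note sub = components_induced[OF G C]
    have "embeds C (transitive_closure (line_graph n) 0)"
      unfolding embeds_def
    proof (intro exI conjI ballI)
      show "inj_on h (verts C)" using h sub(1) by (auto simp: bij_betw_def intro: inj_on_subset)
      have "h ` verts C \<subseteq> {0..<n}" using h sub(1) by (auto simp: bij_betw_def)
      then show "h ` verts C \<subseteq> verts (transitive_closure (line_graph n) 0)"
        by (auto simp: transitive_closure_def line_graph_def)
      fix e assume "e \<in> edges C"
      then have eG: "e \<in> edges G" using sub by blast
      obtain a b where ab: "e = {a, b}" "adj G a b" "a \<noteq> b" using edge_endpoints[OF G eG] by blast
      have V: "a \<in> verts G" "b \<in> verts G" using adj_vertsD[OF G ab(2)] by auto
      then have "h a < n" "h b < n" "h a \<noteq> h b"
        using h ab(3) by (auto simp: bij_betw_def dest: inj_onD)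
      then show "h ` e \<in> edges (transitive_closure (line_graph n) 0)"
        using line_graph_closure ab(1) by simp
    qed
    then show "\<exists>(T :: nat sgraph) r. rooted_tree T r \<and> rooted_depth T r = card (verts G) \<and>
        embeds C (transitive_closure T r)"
      using line_graph_tree[OF n] line_graph_depth[OF n] n_def by blast
  qed
  from LeastI_ex[OF this] show ?thesis using C unfolding tree_depth_def by blast
qed

lemma component_labels:
  fixes G :: "'a sgraph"
  assumes "simple_graph G" "C \<in> components G"
  shows "\<exists>g :: 'a \<Rightarrow> nat list. inj_on g (verts C) \<and>
    (\<forall>x\<in>verts C. g x \<noteq> [] \<and> length (g x) \<le> tree_depth G) \<and>
    (\<forall>x y. {x, y} \<in> edges C \<longrightarrow> prefix (g x) (g y) \<or> prefix (g y) (g x))"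
proof -
  obtain T :: "nat sgraph" and r where T: "rooted_tree T r" "rooted_depth T r = tree_depth G"
    "embeds C (transitive_closure T r)"
    using tree_depth_embeds[OF assms] by blast
  obtain f :: "nat \<Rightarrow> nat list" where f: "inj_on f (verts T)" "\<forall>x\<in>verts T. f x \<noteq> [] \<and> length (f x) \<le> tree_depth G"
    "\<forall>x y. {x, y} \<in> edges (transitive_closure T r) \<longrightarrow> prefix (f x) (f y) \<or> prefix (f y) (f x)"
    using rooted_tree_labels[OF T(1)] T(2) by auto
  obtain \<phi> where \<phi>: "inj_on \<phi> (verts C)" "\<phi> ` verts C \<subseteq> verts T"
    "\<forall>e\<in>edges C. \<phi> ` e \<in> edges (transitive_closure T r)"
    using T(3) by (auto simp: embeds_def transitive_closure_def)
  have "inj_on (f \<circ> \<phi>) (verts C)" using \<phi> f by (meson comp_inj_on inj_on_subset)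
  moreover have "\<forall>x y. {x, y} \<in> edges C \<longrightarrow> prefix (f (\<phi> x)) (f (\<phi> y)) \<or> prefix (f (\<phi> y)) (f (\<phi> x))"
    using \<phi>(3) f(3) by fastforce
  ultimately show ?thesis using \<phi>(2) f(2) by (intro exI[of _ "f \<circ> \<phi>"]) auto
qed

text \<open>Labels from different components may coincide, so every entry is paired with the
  component; the first entry then reveals it.\<close>

lemma tree_depth_labelled_graph:
  fixes G :: "'a sgraph"
  assumes G: "simple_graph G"
  shows "\<exists>lab :: 'a \<Rightarrow> ('a sgraph \<times> nat) list. labelled_graph G lab (tree_depth G)"
proof -
  define comp where "comp u = induced_subgraph G {v. joined G u v}" for u
  have comp: "comp u \<in> components G" if "u \<in> verts G" for u
    using that by (auto simp: components_def comp_def)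
  have "\<forall>C\<in>components G. \<exists>g :: 'a \<Rightarrow> nat list. inj_on g (verts C) \<and>
    (\<forall>x\<in>verts C. g x \<noteq> [] \<and> length (g x) \<le> tree_depth G) \<and>
    (\<forall>x y. {x, y} \<in> edges C \<longrightarrow> prefix (g x) (g y) \<or> prefix (g y) (g x))"
    using component_labels[OF G] by blast
  then obtain g :: "'a sgraph \<Rightarrow> 'a \<Rightarrow> nat list" where g: "\<forall>C\<in>components G. inj_on (g C) (verts C) \<and>
    (\<forall>x\<in>verts C. g C x \<noteq> [] \<and> length (g C x) \<le> tree_depth G) \<and>
    (\<forall>x y. {x, y} \<in> edges C \<longrightarrow> prefix (g C x) (g C y) \<or> prefix (g C y) (g C x))"
    by (rule bchoice[THEN exE])
  define lab where "lab v = map (Pair (comp v)) (g (comp v) v)" for v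
  have self: "v \<in> verts (comp v)" if "v \<in> verts G" for v
    using that by (simp add: comp_def induced_subgraph_def joined_steps)
  have ne: "lab v \<noteq> [] \<and> length (lab v) \<le> tree_depth G" if "v \<in> verts G" for v
    using g comp[OF that] self[OF that] by (auto simp: lab_def)
  have "labelled_graph G lab (tree_depth G)"
  proof
    show "inj_on lab (verts G)"
    proof (rule inj_onI)
      fix x y assume V: "x \<in> verts G" "y \<in> verts G" and eq: "lab x = lab y"
      have "fst (hd (lab x)) = comp x" "fst (hd (lab y)) = comp y"
        using ne[OF V(1)] ne[OF V(2)] by (auto simp: lab_def hd_map)
      then have c: "comp x = comp y" using eq by simp
      then have "g (comp x) x = g (comp x) y"
        using arg_cong[OF eq, of "map snd"] by (simp add: lab_def comp_def[abs_def] o_def)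
      then show "x = y" using g comp[OF V(1)] self[OF V(1)] self[OF V(2)] c by (metis inj_onD)
    qed
    fix u v assume a: "adj G u v"
    have V: "u \<in> verts G" "v \<in> verts G" using adj_vertsD[OF G a] by auto
    have uv: "(u, v) \<in> (steps G (verts G))\<^sup>*" using a V by (auto simp: steps_def)
    have "joined G u w \<longleftrightarrow> joined G v w" for w
      using V rtrancl_trans[OF uv] rtrancl_trans[OF steps_sym[OF uv]] by (auto simp: joined_steps)
    then have c: "comp u = comp v" by (simp add: comp_def)
    have "{u, v} \<in> edges (comp u)"
      using a V uv by (auto simp: comp_def induced_subgraph_def adj_def joined_steps)
    then have "prefix (g (comp u) u) (g (comp u) v) \<or> prefix (g (comp u) v) (g (comp u) u)"
      using g comp[OF V(1)] by blast
    then show "prefix (lab u) (lab v) \<or> prefix (lab v) (lab u)"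
      unfolding lab_def c[symmetric] using map_mono_prefix by blast
  qed (use ne G in auto)
  then show ?thesis by blast
qed

theorem theorem6:
  fixes G :: "'a sgraph" and k d :: nat
  assumes "simple_graph G" and "k \<ge> 1" and "d \<ge> 1" and "tree_depth G = d"
  shows "strong_induced_arboricity k G \<le> (2 * k) ^ d
    \<and> (d \<ge> k + 1 \<longrightarrow>
         strong_induced_arboricity k G \<le> (2 * k) ^ (k + 1) * (d choose (k + 1)))
    \<and> strong_induced_arboricity 1 G \<le> d choose 2"
proof -
  obtain lab :: "'a \<Rightarrow> ('a sgraph \<times> nat) list" where "labelled_graph G lab d"
    using tree_depth_labelled_graph[OF assms(1)] assms(4) by auto
  then interpret labelled_graph G lab d .
  show ?thesis
    using coverable_arboricity[OF coverable_valid[OF assms(2)]]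
      coverable_arboricity[OF coverable_valid_levels[OF assms(2)]]
      coverable_arboricity[OF coverable_valid_one] by blast
qed

end
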